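(* Let $b$ be a prime, $m\in\mathbb{N}$, $N=b^m$, $s\in\mathbb{N}$, $\alpha>1$, let $\boldsymbol{\gamma}=(\gamma_{\mathfrak{u}})_{\mathfrak{u}\subseteq[s]}$ be positive weights with $\gamma_\emptyset=1$, and let $w_1\le w_2\le\cdots\le w_s$ be non-negative integers. Let $\boldsymbol{g}=(Y_1g_1,\ldots,Y_sg_s)\in\mathbb{F}_b[x]^s$, with $Y_j=x^{w_j}$, be constructed by the reduced CBC construction for polynomial lattice rules (described in the context). Then for every $d\in[s]$ and every $\lambda\in(1/\alpha,1]$, $$e_{N,d,\alpha,\boldsymbol{\gamma}}^2\big((Y_1g_1,\ldots,Y_dg_d)\big)\le\left(\frac{b}{b-1}\sum_{\emptyset\ne\mathfrak{u}\subseteq[d]}\gamma_{\mathfrak{u}}^\lambda\,\frac{\mu_b(\alpha\lambda)^{|\mathfrak{u}|}}{b^{\max\{0,\,m-\max_{j\in\mathfrak{u}}w_j\}}}\right)^{1/\lambda},$$ where $\mu_b(\beta)=\sum_{h=1}^\infty b^{-\beta\lfloor\log_bh\rfloor}=\frac{b^\beta(b-1)}{b^\beta-b}$ for $\beta>1$.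
   Context: Notation: $[d]=\{1,\ldots,d\}$; $\mathbb{F}_b$ is the field with $b$ elements; $\boldsymbol{x}_{\mathfrak{u}}=(x_j)_{j\in\mathfrak{u}}$; $\psi_b(h)=\lfloor\log_bh\rfloor$ for $h\in\mathbb{N}$. A non-negative integer $n=n_0+n_1b+\cdots+n_rb^r$ with digits $n_i\in\{0,\ldots,b-1\}$ is identified with the polynomial $n_0+n_1x+\cdots+n_rx^r\in\mathbb{F}_b[x]$ and vice versa (so $\psi_b(h)=\deg h$ for $h\neq0$); all arithmetic with such objects is polynomial arithmetic. Weighted Walsh space: $\mathcal{H}(K^{\mathrm{wal}}_{d,\alpha,\boldsymbol{\gamma}})$ is the reproducing kernel Hilbert space of functions on $[0,1)^d$ with kernel $$K^{\mathrm{wal}}_{d,\alpha,\boldsymbol{\gamma}}(\boldsymbol{x},\boldsymbol{y})=1+\sum_{\emptyset\ne\mathfrak{u}\subseteq[d]}\gamma_{\mathfrak{u}}\sum_{\boldsymbol{h}_{\mathfrak{u}}\in\mathbb{N}^{|\mathfrak{u}|}}\frac{\mathrm{wal}_{\boldsymbol{h}_{\mathfrak{u}}}(\boldsymbol{x}_{\mathfrak{u}})\overline{\mathrm{wal}_{\boldsymbol{h}_{\mathfrak{u}}}(\boldsymbol{y}_{\mathfrak{u}})}}{\prod_{j\in\mathfrak{u}}b^{\alpha\psi_b(h_j)}},$$ where $\mathrm{wal}_{\boldsymbol{h}}$ is the $\boldsymbol{h}$th Walsh function in base $b$ (product of one-dimensional Walsh functions $\mathrm{wal}_h(y)=\exp(2\pi\mathrm{i}(h_0y_1+h_1y_2+\cdots)/b)$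 for $h=\sum_ih_ib^i$ and $y=\sum_{i\ge1}y_ib^{-i}$ the usual $b$-adic digit expansion). Polynomial lattice rule: for $\boldsymbol{g}=(g_1,\ldots,g_d)\in\mathbb{F}_b[x]^d$, the point set $\mathcal{P}(\boldsymbol{g},x^m)$ consists of the $b^m$ points $\left(\nu\left(\frac{ng_1}{x^m}\right),\ldots,\nu\left(\frac{ng_d}{x^m}\right)\right)$ for $n\in\mathbb{F}_b[x]$ with $\deg n<m$, where for $f=a_0+a_1x+\cdots\in\mathbb{F}_b[x]$, $\nu\left(\frac{f}{x^m}\right)=\frac{a_{m-1}}{b}+\frac{a_{m-2}}{b^2}+\cdots+\frac{a_0}{b^m}$ (coefficients $a_i$ with $i\ge m$ are ignored; missing coefficients are $0$). $e_{N,d,\alpha,\boldsymbol{\gamma}}(\boldsymbol{g})$ is the worst-case error of the equal-weight quadrature rule based on $\mathcal{P}(\boldsymbol{g},x^m)$ over the unit ball of $\mathcal{H}(K^{\mathrm{wal}}_{d,\alpha,\boldsymbol{\gamma}})$ (supremum of $|\int_{[0,1]^d}f-\frac1N\sum_{\boldsymbol{x}\in\mathcal{P}(\boldsymbol{g},x^m)}f(\boldsymbol{x})|$). It is known that $$e_{N,d,\alpha,\boldsymbol{\gamma}}^2(\boldsymbol{g})=\sum_{\emptyset\ne\mathfrak{u}\subseteq[d]}\gamma_{\mathfrak{u}}\sum_{\boldsymbol{h}_{\mathfrak{u}}\in\mathcal{D}_{\mathfrak{u}}}\prod_{j\in\mathfrak{u}}b^{-\alpha\psi_b(h_j)},\qquad\mathcal{D}_{\mathfrak{u}}=\{\boldsymbol{h}_{\mathfrak{u}}\in(\mathbb{F}_b[x]\setminus\{0\})^{|\mathfrak{u}|}:\boldsymbol{h}_{\mathfrak{u}}\cdot\boldsymbol{g}_{\mathfrak{u}}\equiv0\pmod{x^m}\}.$$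 Reduced CBC construction for polynomial lattice rules: put $\mathcal{Z}_{b^m,w_j}=\{h\in\mathbb{F}_b[x]\setminus\{0\}:\deg h<m-w_j,\ \gcd(h,x^m)=1\}$ if $w_j<m$ and $\mathcal{Z}_{b^m,w_j}=\{1\}$ if $w_j\ge m$; $Y_j=x^{w_j}$. Set $g_1=1$. For $d=1,\ldots,s-1$ successively, given $g_1,\ldots,g_d$, choose $g_{d+1}\in\mathcal{Z}_{b^m,w_{d+1}}$ minimizing $e_{N,d+1,\alpha,\boldsymbol{\gamma}}^2((Y_1g_1,\ldots,Y_dg_d,Y_{d+1}g_{d+1}))$ as a function of $g_{d+1}$. The output is $\boldsymbol{g}=(Y_1g_1,\ldots,Y_sg_s)$. *)

theory Defs
  imports
    "HOL-Analysis.Analysis"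
    "Berlekamp_Zassenhaus.Finite_Field"
begin

section \<open>Reproducing kernel Hilbert spaces\<close>

definition ip_norm :: "(('x \<Rightarrow> complex) \<Rightarrow> ('x \<Rightarrow> complex) \<Rightarrow> complex) \<Rightarrow> ('x \<Rightarrow> complex) \<Rightarrow> real"
  where "ip_norm ip f = sqrt (Re (ip f f))"

text \<open>
  \<open>rkhs X K H ip\<close>: the set \<open>H\<close> with inner product \<open>ip\<close> is a complex Hilbert space of functions
  on \<open>X\<close> with reproducing kernel \<open>K\<close>.  A function on \<open>X\<close> is represented by the function on the
  whole type that vanishes outside \<open>X\<close>.  By the Moore-Aronszajn theorem, a positive semidefinite
  \<open>K\<close> determines \<open>H\<close> and (on \<open>H\<close>) \<open>ip\<close>.
\<close>

locale rkhs =
  fixes X :: "'x set"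
    and K :: "'x \<Rightarrow> 'x \<Rightarrow> complex"
    and H :: "('x \<Rightarrow> complex) set"
    and ip :: "('x \<Rightarrow> complex) \<Rightarrow> ('x \<Rightarrow> complex) \<Rightarrow> complex"
  assumes supported: "f \<in> H \<Longrightarrow> x \<notin> X \<Longrightarrow> f x = 0"
    and zero_closed: "(\<lambda>x. 0) \<in> H"
    and add_closed: "f \<in> H \<Longrightarrow> g \<in> H \<Longrightarrow> (\<lambda>x. f x + g x) \<in> H"
    and scale_closed: "f \<in> H \<Longrightarrow> (\<lambda>x. c * f x) \<in> H"
    and ip_add: "f \<in> H \<Longrightarrow> g \<in> H \<Longrightarrow> k \<in> H \<Longrightarrow> ip (\<lambda>x. f x + g x) k = ip f k + ip g k"
    and ip_scale: "f \<in> H \<Longrightarrow> g \<in> H \<Longrightarrow> ip (\<lambda>x. c * f x) g = c * ip f g"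
    and ip_conj: "f \<in> H \<Longrightarrow> g \<in> H \<Longrightarrow> ip g f = cnj (ip f g)"
    and ip_nonneg: "f \<in> H \<Longrightarrow> 0 \<le> Re (ip f f)"
    and ip_definite: "f \<in> H \<Longrightarrow> ip f f = 0 \<Longrightarrow> f = (\<lambda>x. 0)"
    and complete:
      "(\<And>n. F n \<in> H) \<Longrightarrow>
       (\<And>e. e > 0 \<Longrightarrow> \<exists>M. \<forall>i\<ge>M. \<forall>j\<ge>M. ip_norm ip (\<lambda>x. F i x - F j x) < e) \<Longrightarrow>
       \<exists>f\<in>H. (\<lambda>n. ip_norm ip (\<lambda>x. F n x - f x)) \<longlonglongrightarrow> 0"
    and kernel_mem: "y \<in> X \<Longrightarrow> (\<lambda>x. if x \<in> X then K x y else 0) \<in> H"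
    and reproducing: "f \<in> H \<Longrightarrow> y \<in> X \<Longrightarrow> f y = ip f (\<lambda>x. if x \<in> X then K x y else 0)"

section \<open>The weighted Walsh space\<close>

definition psi :: "nat \<Rightarrow> nat \<Rightarrow> nat"
  where "psi b h = nat \<lfloor>log (real b) (real h)\<rfloor>"

text \<open>
  The digit \<open>y\<^sub>i\<close> of \<open>y \<in> [0,1)\<close> is \<open>\<lfloor>b^i y\<rfloor> mod b\<close>; this is the expansion with infinitely many
  digits different from \<open>b - 1\<close>.
\<close>

definition wal :: "nat \<Rightarrow> nat \<Rightarrow> real \<Rightarrow> complex" where
  "wal b h y = exp (2 * of_real pi * \<i> *
     of_int (\<Sum>i\<le>psi b h. int (h div b ^ i mod b) * (\<lfloor>real b ^ Suc i * y\<rfloor> mod int b)) / of_nat b)"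

definition unit_cube :: "nat \<Rightarrow> (nat \<Rightarrow> real) set"
  where "unit_cube d = {1..d} \<rightarrow>\<^sub>E {0..<1}"

definition walsh_kernel ::
  "nat \<Rightarrow> nat \<Rightarrow> real \<Rightarrow> (nat set \<Rightarrow> real) \<Rightarrow> (nat \<Rightarrow> real) \<Rightarrow> (nat \<Rightarrow> real) \<Rightarrow> complex" where
  "walsh_kernel b d \<alpha> \<gamma> x y = 1 + (\<Sum>u\<in>Pow {1..d} - {{}}. of_real (\<gamma> u) *
     (\<Sum>\<^sub>\<infinity>h\<in>u \<rightarrow>\<^sub>E {1..}.
        (\<Prod>j\<in>u. wal b (h j) (x j)) * cnj (\<Prod>j\<in>u. wal b (h j) (y j)) /
        of_real (\<Prod>j\<in>u. real b powr (\<alpha> * real (psi b (h j))))))"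

section \<open>Polynomial lattice rules with modulus \<open>x^m\<close>\<close>

definition nu :: "nat \<Rightarrow> 'p::prime_card mod_ring poly \<Rightarrow> real" where
  "nu m f = (\<Sum>i=1..m. of_int (to_int_mod_ring (poly.coeff f (m - i))) / real CARD('p) ^ i)"

definition lattice_point ::
  "nat \<Rightarrow> nat \<Rightarrow> (nat \<Rightarrow> 'p::prime_card mod_ring poly) \<Rightarrow> 'p mod_ring poly \<Rightarrow> nat \<Rightarrow> real" where
  "lattice_point m d g n = (\<lambda>j\<in>{1..d}. nu m (n * g j))"

text \<open>
  For \<open>m \<ge> 1\<close> the condition \<open>degree n < m\<close> includes \<open>n = 0\<close>, since \<open>degree 0 = 0\<close>.  Summing over
  \<open>n\<close> counts points with multiplicity.
\<close>

definition lattice_rule ::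
  "nat \<Rightarrow> nat \<Rightarrow> (nat \<Rightarrow> 'p::prime_card mod_ring poly) \<Rightarrow> ((nat \<Rightarrow> real) \<Rightarrow> complex) \<Rightarrow> complex" where
  "lattice_rule m d g f =
     (\<Sum>n | degree n < m. f (lattice_point m d g n)) / of_nat (CARD('p) ^ m)"

definition worst_case_error ::
  "nat \<Rightarrow> nat \<Rightarrow> ((nat \<Rightarrow> real) \<Rightarrow> complex) set \<Rightarrow>
   (((nat \<Rightarrow> real) \<Rightarrow> complex) \<Rightarrow> ((nat \<Rightarrow> real) \<Rightarrow> complex) \<Rightarrow> complex) \<Rightarrow>
   (nat \<Rightarrow> 'p::prime_card mod_ring poly) \<Rightarrow> real" where
  "worst_case_error m d H ip g =
     (SUP f\<in>{f \<in> H. ip_norm ip f \<le> 1}.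
        cmod (set_lebesgue_integral (Pi\<^sub>M {1..d} (\<lambda>_. lborel)) (unit_cube d) f - lattice_rule m d g f))"

section \<open>The reduced component-by-component construction\<close>

definition search_set :: "nat \<Rightarrow> nat \<Rightarrow> 'p::prime_card mod_ring poly set" where
  "search_set m v =
     (if v < m then {h. h \<noteq> 0 \<and> degree h < m - v \<and> gcd h (Polynomial.monom 1 m) = 1} else {1})"

text \<open>
  \<open>g j\<close> is the unscaled component; the generating vector has components \<open>x^(w j) * g j\<close>.
  The function \<open>E d\<close> is the error criterion in dimension \<open>d\<close>, applied to generating vectors.
\<close>

definition scaled :: "(nat \<Rightarrow> nat) \<Rightarrow> (nat \<Rightarrow> 'p::prime_card mod_ring poly) \<Rightarrow> nat \<Rightarrow> 'p mod_ring poly"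
  where "scaled w g = (\<lambda>j. Polynomial.monom 1 (w j) * g j)"

definition reduced_cbc ::
  "nat \<Rightarrow> nat \<Rightarrow> (nat \<Rightarrow> nat) \<Rightarrow> (nat \<Rightarrow> (nat \<Rightarrow> 'p::prime_card mod_ring poly) \<Rightarrow> real) \<Rightarrow>
   (nat \<Rightarrow> 'p mod_ring poly) \<Rightarrow> bool" where
  "reduced_cbc m s w E g \<longleftrightarrow>
     g 1 = 1 \<and>
     (\<forall>d\<in>{1..<s}. is_arg_min (\<lambda>h. E (Suc d) (scaled w (g(Suc d := h))))
                     (\<lambda>h. h \<in> search_set m (w (Suc d))) (g (Suc d)))"

definition mu :: "nat \<Rightarrow> real \<Rightarrow> real"
  where "mu b \<beta> = (\<Sum>h. real b powr (- \<beta> * real (psi b (Suc h))))"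

end

theory Submission
  imports Defs
begin

text \<open>
  The constant function 1 is the norm limit of averages of kernel sections over the finer and finer
  \<open>b\<close>-adic grids, and it represents the integral.  Hence the worst-case error is the norm of 1 minus the
  average of the kernel sections at the lattice points; character orthogonality turns its square into
  the weighted sum over the dual lattice.

  Adding component \<open>d + 1\<close> increases this sum by a term \<open>\<theta>(g)\<close>.  As \<open>(\<Sum>a)\<^sup>\<lambda> \<le> \<Sum>a\<^sup>\<lambda>\<close>,
  the minimum of \<open>\<theta>\<^sup>\<lambda>\<close> is at most the average over the search set of the same sum with \<open>\<gamma>\<close> and the weights
  raised to the power \<open>\<lambda>\<close>.  That average is small: if \<open>x^v\<close> divides the contribution \<open>c\<close> of the
  old components exactly, only multiples of \<open>x^v\<close> solve \<open>k z + c = 0\<close> modulo \<open>x^M\<close> with a unit \<open>z\<close>, each of them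
  for at most \<open>b^v\<close> values of \<open>z\<close>, while the weights of the multiples of \<open>x^v\<close> sum to at most \<open>\<mu> / b^v\<close>.
\<close>

section \<open>Walsh weights\<close>

text \<open>The Hilbert space is known only through its axioms: neither membership of 1, nor
  measurability of its functions, nor boundedness of integration is given. Grid averages supply all
  three. The grids are nested, and averaging over one kills, in each coordinate, every Walsh
  frequency not divisible by b^n, so the inner product of two averages depends only on the finer
  grid; hence the averages form a Cauchy sequence. Each member of the space is the pointwise limit
  of its own step functions on these grids, which gives measurability and identifies the limit of
  the grid rules with the integral. The factor b/(b-1) stems from the size of the search set: among
  the b^M polynomials of degree below M = m - w, those with non-zero constant term are units modulo
  x^m, a share of 1 - 1/b. The condition \<lambda> > 1/\<alpha> makes the series for
  \<open>mu\<close> at \<alpha>\<lambda> converge. As the w_j are nondecreasing, the newest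
  component carries the maximum over every subset containing it, so averaging over its own search
  set yields the required denominator.\<close>

definition walsh_weight :: "nat \<Rightarrow> real \<Rightarrow> nat \<Rightarrow> real"
  where "walsh_weight b \<beta> h = real b powr (- \<beta> * real (psi b h))"

lemma walsh_weight_nonneg [simp]: "0 \<le> walsh_weight b \<beta> h"
  by (simp add: walsh_weight_def)

lemma psi_eqI:
  assumes "2 \<le> b" "b ^ k \<le> h" "h < b ^ Suc k"
  shows "psi b h = k"
  using floor_log_nat_eq_if[of b k h] assms by (simp add: psi_def)

lemma psi_bounds:
  assumes "2 \<le> b" "1 \<le> h"
  shows "b ^ psi b h \<le> h" "h < b ^ Suc (psi b h)"
proof -
  obtain k where k: "b ^ k \<le> h" "h < b ^ (k + 1)"
    using ex_power_ivl1[of b h] assms by auto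
  then have "psi b h = k"
    using assms by (intro psi_eqI) auto
  with k show "b ^ psi b h \<le> h" "h < b ^ Suc (psi b h)"
    by auto
qed

lemma psi_power_mult:
  assumes "2 \<le> b" "1 \<le> h"
  shows "psi b (b ^ v * h) = v + psi b h"
  using psi_bounds[OF assms] assms by (intro psi_eqI) (auto simp: power_add)

lemma walsh_weight_power_mult:
  assumes "2 \<le> b" "1 \<le> h"
  shows "walsh_weight b \<beta> (b ^ v * h) = real b powr (- \<beta> * real v) * walsh_weight b \<beta> h"
  unfolding walsh_weight_def psi_power_mult[OF assms] powr_add[symmetric] of_nat_add
  by (simp add: ring_distribs)

lemma walsh_weight_powr:
  "walsh_weight b \<beta> h powr l = walsh_weight b (\<beta> * l) h"
  by (simp add: walsh_weight_def powr_powr algebra_simps)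

text \<open>The weight is constant on each block from b^k to b^(k+1) - 1, so a block contributes (b
  - 1) q^k with q = b^(1-\<beta>) < 1, and the blocks form a geometric series.\<close>

lemma has_sum_walsh_weight:
  assumes b: "2 \<le> b" and \<beta>: "\<beta> > 1"
  shows "(walsh_weight b \<beta> has_sum (real b powr \<beta> * (real b - 1) / (real b powr \<beta> - real b))) {1..}"
    (is "(_ has_sum ?S) _")
proof -
  define q where "q = real b powr (1 - \<beta>)"
  have q: "0 < q" "q < 1"
    using b \<beta> by (auto simp: q_def powr_less_one)
  have inner: "((\<lambda>h. walsh_weight b \<beta> h) has_sum ((real b - 1) * q ^ k)) {b ^ k..<b ^ Suc k}" for k
  proof (rule has_sum_finiteI)
    have "(\<Sum>h\<in>{b ^ k..<b ^ Suc k}. walsh_weight b \<beta> h) = (\<Sum>h\<in>{b ^ k..<b ^ Suc k}. real b powr (- \<beta> * real k))"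
      using b by (intro sum.cong refl) (auto simp: walsh_weight_def psi_eqI)
    also have "\<dots> = (real b - 1) * (real b ^ k * real b powr (- \<beta> * real k))"
      using b by (simp add: of_nat_diff algebra_simps)
    also have "real b ^ k * real b powr (- \<beta> * real k) = q ^ k"
      using b by (simp add: q_def powr_realpow[symmetric] powr_powr powr_add[symmetric] algebra_simps)
    finally show "(real b - 1) * q ^ k = (\<Sum>h\<in>{b ^ k..<b ^ Suc k}. walsh_weight b \<beta> h)"
      by simp
  qed simp
  have outer: "((\<lambda>k. (real b - 1) * q ^ k) has_sum ((real b - 1) * (1 / (1 - q)))) UNIV"
    using q b by (intro sums_nonneg_imp_has_sum sums_mult geometric_sums) auto
  have "((\<lambda>(k, h). walsh_weight b \<beta> h) has_sum ((real b - 1) * (1 / (1 - q))))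
          (SIGMA k:UNIV. {b ^ k..<b ^ Suc k})"
    using inner outer
    by (intro has_sum_SigmaI summable_on_SigmaI[where g = "\<lambda>k. (real b - 1) * q ^ k"])
       (auto simp: summable_on_def)
  also have "?this \<longleftrightarrow> (walsh_weight b \<beta> has_sum ((real b - 1) * (1 / (1 - q)))) {1..}"
  proof (rule has_sum_reindex_bij_witness[of _ "\<lambda>h. (psi b h, h)" snd])
    fix x assume "x \<in> (SIGMA k:UNIV. {b ^ k..<b ^ Suc k})"
    then show "(psi b (snd x), snd x) = x" "snd x \<in> {1..}"
      using b by (auto simp: psi_eqI) (metis One_nat_def Suc_leI le_trans not_less_eq_eq one_le_power
          numeral_2_eq_2 le_SucI)
  qed (use psi_bounds[OF b] in auto)
  also have "(real b - 1) * (1 / (1 - q)) = ?S"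
  proof -
    have q': "q = real b / real b powr \<beta>" 
      using b by (simp add: q_def powr_diff)
    have "real b powr 1 < real b powr \<beta>"
      using b \<beta> by (subst powr_less_cancel_iff) auto
    then show ?thesis
      using b by (simp add: q' field_simps)
  qed
  finally show ?thesis .
qed

lemma has_sum_mu:
  assumes "2 \<le> b" "\<beta> > 1"
  shows "(walsh_weight b \<beta> has_sum mu b \<beta>) {1..}"
proof -
  obtain S where S: "(walsh_weight b \<beta> has_sum S) {1..}"
    using has_sum_walsh_weight[OF assms] by blast
  also have "?this \<longleftrightarrow> ((\<lambda>h. walsh_weight b \<beta> (Suc h)) has_sum S) UNIV"
    by (rule has_sum_reindex_bij_witness[of _ Suc "\<lambda>h. h - 1"]) auto
  finally have "(\<lambda>h. walsh_weight b \<beta> (Suc h)) sums S"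
    by (rule has_sum_imp_sums)
  with S show ?thesis
    by (simp add: mu_def sums_iff walsh_weight_def)
qed

lemma mu_eq:
  assumes "2 \<le> b" "\<beta> > 1"
  shows "mu b \<beta> = real b powr \<beta> * (real b - 1) / (real b powr \<beta> - real b)"
  using has_sum_unique[OF has_sum_mu has_sum_walsh_weight] assms by blast

lemma mu_nonneg:
  assumes "2 \<le> b" "\<beta> > 1"
  shows "0 \<le> mu b \<beta>"
  using has_sum_nonneg[OF has_sum_mu[OF assms]] by simp

text \<open>Multiplying h by b^v appends v zero digits, which raises \<open>psi\<close> by v and
  scales every weight by the same factor.\<close>

lemma has_sum_multiples:
  assumes b: "2 \<le> b" and "\<beta> > 1"
  shows "(walsh_weight b \<beta> has_sum (real b powr (- \<beta> * real v) * mu b \<beta>)) {h. 1 \<le> h \<and> b ^ v dvd h}"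
proof -
  have "((\<lambda>h. real b powr (- \<beta> * real v) * walsh_weight b \<beta> h) has_sum (real b powr (- \<beta> * real v) * mu b \<beta>)) {1..}"
    using has_sum_mu[OF assms] by (rule has_sum_cmult_right)
  also have "?this \<longleftrightarrow> ?thesis"
    using b by (intro has_sum_reindex_bij_witness[of _ "\<lambda>h. h div b ^ v" "\<lambda>h. b ^ v * h"])
      (auto simp: walsh_weight_power_mult Suc_le_eq intro!: div_greater_zero_iff[THEN iffD2] dvd_imp_le)
  finally show ?thesis .
qed

text \<open>Since \<beta> > 1, b^(-\<beta>v) is at most b^(-v). The weaker power is exactly what
  absorbs the up to b^v solutions counted in \<open>search_set_solutions\<close>.\<close>

lemma mu_multiples_le:
  assumes "2 \<le> b" "\<beta> > 1"
  shows "real b powr (- \<beta> * real v) * mu b \<beta> \<le> mu b \<beta> / real b ^ v"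
proof -
  have "real b powr (- \<beta> * real v) \<le> real b powr (- real v)"
    using assms by (intro powr_mono) (auto simp: mult_le_cancel_right1)
  also have "\<dots> = 1 / real b ^ v"
    using assms by (simp add: powr_minus powr_realpow inverse_eq_divide)
  finally show ?thesis
    using mu_nonneg[OF assms] by (metis mult_right_mono mult.left_neutral times_divide_eq_left)
qed

section \<open>Digits and characters\<close>

lemma card_ge_2: "2 \<le> CARD('p::prime_card)"
  using prime_card[where 'a = 'p] by (rule prime_ge_2_nat)

lemma to_int_of_nat_mod_ring:
  "to_int_mod_ring (of_nat k :: 'p::prime_card mod_ring) = int (k mod CARD('p))"
proof -
  have "(of_nat k :: 'p mod_ring) = of_int_mod_ring (int (k mod CARD('p)))"
    unfolding of_int_of_int_mod_ring[symmetric] of_int_of_nat_eq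
    using of_nat_mod_CHAR[where ?'a = "'p mod_ring"] by (simp only: semiring_char_mod_ring)
  then show ?thesis
    by (simp add: to_int_mod_ring_of_int_mod_ring)
qed

lemma of_int_to_int_mod_ring [simp]: "of_int (to_int_mod_ring a) = (a :: 'p::prime_card mod_ring)"
  by (simp add: of_int_of_int_mod_ring)

lemma to_int_mod_ring_bounds:
  "0 \<le> to_int_mod_ring (a :: 'p::prime_card mod_ring)" "to_int_mod_ring a < int CARD('p)"
  using range_to_int_mod_ring[where 'a = 'p] by (auto simp: set_eq_iff)

section \<open>The additive character of the field with b elements\<close>

definition chi :: "'p::prime_card mod_ring \<Rightarrow> complex"
  where "chi a = cis (2 * pi * of_int (to_int_mod_ring a) / real CARD('p))"

text \<open>An integer and its reduced representative differ by a multiple of b, which shifts the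
  angle by a multiple of 2 pi. With this, additivity of \<open>chi\<close> becomes additivity of
  angles.\<close>

lemma chi_of_int:
  "chi (of_int k :: 'p::prime_card mod_ring) = cis (2 * pi * of_int k / real CARD('p))"
proof -
  let ?b = "CARD('p)"
  let ?r = "to_int_mod_ring (of_int k :: 'p mod_ring)"
  have "?r = k mod int ?b"
    using to_int_of_nat_mod_ring[where 'p = 'p, of "nat (k mod int ?b)"]
      of_int_mod_CHAR[where ?'a = "'p mod_ring", of k]
    by (simp add: semiring_char_mod_ring of_nat_nat zmod_int)
  then obtain q where q: "k = ?r + int ?b * q"
    by (metis mod_mult_div_eq)
  have "2 * pi * of_int k / real ?b = 2 * pi * of_int ?r / real ?b + 2 * pi * of_int q"
    by (subst q) (simp add: field_simps)
  then show ?thesis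
    by (simp only: chi_def cis_mult[symmetric] cis_multiple_2pi Ints_of_int mult_1_right)
qed

lemma chi_add: "chi (a + c) = chi a * chi (c :: 'p::prime_card mod_ring)"
proof -
  have "chi (a + c) = chi (of_int (to_int_mod_ring a + to_int_mod_ring c) :: 'p mod_ring)"
    by (simp only: of_int_add of_int_to_int_mod_ring)
  also have "\<dots> = chi a * chi c"
    unfolding chi_of_int by (simp add: chi_def cis_mult add_divide_distrib ring_distribs)
  finally show ?thesis .
qed

lemma chi_0 [simp]: "chi 0 = 1"
  using chi_of_int[of 0] by simp

lemma norm_chi [simp]: "norm (chi a) = 1"
  by (simp add: chi_def)

lemma chi_sum: "finite A \<Longrightarrow> chi (\<Sum>x\<in>A. f x) = (\<Prod>x\<in>A. chi (f x))"
  by (induction A rule: finite_induct) (auto simp: chi_add)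

lemma chi_eq_1D:
  assumes "chi (a :: 'p::prime_card mod_ring) = 1"
  shows "a = 0"
proof -
  let ?t = "to_int_mod_ring a"
  have "cos (2 * pi * of_int ?t / real CARD('p)) = 1"
    using assms by (simp add: chi_def complex_eq_iff)
  then obtain n where "2 * pi * of_int ?t / real CARD('p) = of_int n * 2 * pi"
    using cos_one_2pi_int by blast
  then have "real_of_int ?t = of_int n * real CARD('p)"
    by (simp add: field_simps)
  then have "?t = n * int CARD('p)"
    by (metis of_int_eq_iff of_int_mult of_int_of_nat_eq)
  with to_int_mod_ring_bounds[of a] have "?t = 0"
    by (metis mod_mult_self2_is_0 mod_pos_pos_trivial)
  then show ?thesis
    by (metis of_int_0 of_int_to_int_mod_ring)
qed

section \<open>Integers as polynomials over the field\<close>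

text \<open>The cut-off i < h loses nothing because h < b^h. The quotients are reduced modulo b, and
  so become digits, by \<open>of_nat\<close> into the field.\<close>

definition digit_poly :: "nat \<Rightarrow> 'p::prime_card mod_ring poly"
  where "digit_poly h = (\<Sum>i<h. Polynomial.monom (of_nat (h div CARD('p) ^ i)) i)"

lemma coeff_digit_poly:
  "poly.coeff (digit_poly h :: 'p::prime_card mod_ring poly) i = of_nat (h div CARD('p) ^ i)"
proof (cases "i < h")
  case False
  then have "h < CARD('p) ^ i"
    using card_ge_2[where 'p = 'p]
    by (metis le_less_trans less_exp linorder_not_less power_mono le_trans zero_le_numeral less_imp_le_nat)
  with False show ?thesis
    by (simp add: digit_poly_def coeff_sum)
qed (simp add: digit_poly_def coeff_sum)

lemma sum_digits: "(\<Sum>j<M. (k div b ^ j mod b) * b ^ j) = k mod b ^ M" for k b M :: nat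
proof (induction M)
  case (Suc M)
  then show ?case
    using mod_mult2_eq[of k "b ^ M" b] by (simp add: mult.commute)
qed simp

lemma dvd_digit_poly_iff:
  "Polynomial.monom 1 v dvd (digit_poly h :: 'p::prime_card mod_ring poly) \<longleftrightarrow> CARD('p) ^ v dvd h"
proof -
  let ?b = "CARD('p)"
  have "Polynomial.monom 1 v dvd (digit_poly h :: 'p mod_ring poly) \<longleftrightarrow> (\<forall>j<v. (of_nat (h div ?b ^ j) :: 'p mod_ring) = 0)"
    by (simp add: monom_1_dvd_iff' coeff_digit_poly)
  also have "\<dots> \<longleftrightarrow> (\<forall>j<v. h div ?b ^ j mod ?b = 0)"
    by (metis to_int_of_nat_mod_ring of_nat_0_mod_ring_dvd dvd_eq_mod_eq_0 of_nat_0_eq_iff of_int_0 of_int_to_int_mod_ring)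
  also have "\<dots> \<longleftrightarrow> h mod ?b ^ v = 0"
    using card_ge_2[where 'p = 'p] by (auto simp flip: sum_digits)
  finally show ?thesis
    by (simp add: dvd_eq_mod_eq_0)
qed

section \<open>The map nu and base-b digits\<close>

text \<open>\<open>nu\<close> makes the coefficient of x^(m-1) the leading digit, so b^m times its
  value is the integer whose base-b digits are the coefficients in their usual order.\<close>

definition nu_num :: "nat \<Rightarrow> 'p::prime_card mod_ring poly \<Rightarrow> nat"
  where "nu_num m f = (\<Sum>j<m. nat (to_int_mod_ring (poly.coeff f j)) * CARD('p) ^ j)"

lemma nu_num_bound: "nu_num m (f :: 'p::prime_card mod_ring poly) < CARD('p) ^ m"
proof (induction m)
  case (Suc m)
  have "nat (to_int_mod_ring (poly.coeff f m)) < CARD('p)"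
    using to_int_mod_ring_bounds[of "poly.coeff f m"] by linarith
  then have "Suc (nat (to_int_mod_ring (poly.coeff f m))) * CARD('p) ^ m \<le> CARD('p) * CARD('p) ^ m"
    by (intro mult_right_mono) auto
  with Suc show ?case
    by (simp add: nu_num_def)
qed (simp add: nu_num_def)

lemma nu_num_digit:
  assumes "j < m"
  shows "nu_num m f div CARD('p) ^ j mod CARD('p) = nat (to_int_mod_ring (poly.coeff (f :: 'p::prime_card mod_ring poly) j))"
  using assms
proof (induction m)
  case (Suc m)
  let ?b = "CARD('p)"
  let ?a = "\<lambda>j. nat (to_int_mod_ring (poly.coeff f j))"
  have step: "nu_num (Suc m) f = nu_num m f + ?a m * ?b ^ m"
    by (simp add: nu_num_def)
  have a: "?a j < ?b" for j
    using to_int_mod_ring_bounds[of "poly.coeff f j"] by linarith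
  show ?case
  proof (cases "j = m")
    case True
    then show ?thesis
      using a nu_num_bound[of m f] by (simp add: step)
  next
    case False
    with Suc.prems have j: "j < m" by simp
    then have "?a m * ?b ^ m = (?b * (?b ^ (m - Suc j) * ?a m)) * ?b ^ j"
      by (simp add: power_Suc[symmetric] power_add[symmetric] mult.commute mult.left_commute del: power_Suc)
    then have "nu_num (Suc m) f div ?b ^ j = nu_num m f div ?b ^ j + ?b * (?b ^ (m - Suc j) * ?a m)"
      using div_mult_self1[of "?b ^ j" "nu_num m f" "?b * (?b ^ (m - Suc j) * ?a m)"] by (simp only: step) simp
    with Suc.IH[OF j] show ?thesis
      by (simp add: add.commute)
  qed
qed simp

lemma nu_eq: "nu m f = real (nu_num m f) / real CARD('p) ^ m" for f :: "'p::prime_card mod_ring poly"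
proof -
  let ?b = "CARD('p)"
  have "nu m f = (\<Sum>j<m. of_int (to_int_mod_ring (poly.coeff f j)) / real ?b ^ (m - j))"
    unfolding nu_def
    by (rule sum.reindex_bij_witness[of _ "\<lambda>j. m - j" "\<lambda>i. m - i"]) auto
  also have "\<dots> = (\<Sum>j<m. of_int (to_int_mod_ring (poly.coeff f j)) * real ?b ^ j / real ?b ^ m)"
    by (intro sum.cong refl) (simp add: power_diff field_simps)
  also have "\<dots> = real (nu_num m f) / real ?b ^ m"
    by (simp add: nu_num_def sum_divide_distrib to_int_mod_ring_bounds)
  finally show ?thesis .
qed

lemma nu_in_unit_interval: "nu m f \<in> {0..<1}"
proof -
  have "real (nu_num m f) < real (CARD('a) ^ m)"
    using nu_num_bound[of m f] by (simp only: of_nat_less_iff)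
  then show ?thesis
    by (simp add: nu_eq)
qed

text \<open>The inverse map is \<open>digit_poly\<close>. Thus the values of \<open>nu\<close> on
  the polynomials of degree below m run exactly once through the multiples of b^(-m) in
  [0,1).\<close>

lemma bij_betw_nu_num:
  assumes "1 \<le> m"
  shows "bij_betw (nu_num m) {f :: 'p::prime_card mod_ring poly. degree f < m} {..<CARD('p) ^ m}"
proof (rule bij_betw_imageI)
  show "inj_on (nu_num m) {f :: 'p mod_ring poly. degree f < m}"
  proof (rule inj_onI)
    fix f g :: "'p mod_ring poly"
    assume deg: "f \<in> {f. degree f < m}" "g \<in> {f. degree f < m}" and eq: "nu_num m f = nu_num m g"
    show "f = g"
    proof (rule poly_eqI)
      fix j
      show "poly.coeff f j = poly.coeff g j"
      proof (cases "j < m")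
        case True
        then have "nat (to_int_mod_ring (poly.coeff f j)) = nat (to_int_mod_ring (poly.coeff g j))"
          using nu_num_digit[of j m f] nu_num_digit[of j m g] eq by simp
        then show ?thesis
          by (metis eq_nat_nat_iff of_int_to_int_mod_ring to_int_mod_ring_bounds(1))
      qed (use deg in \<open>auto simp: coeff_eq_0\<close>)
    qed
  qed
  show "nu_num m ` {f :: 'p mod_ring poly. degree f < m} = {..<CARD('p) ^ m}"
  proof (intro equalityI subsetI)
    fix k assume k: "k \<in> {..<CARD('p) ^ m}"
    have "nu_num m (digit_poly k :: 'p mod_ring poly) = k mod CARD('p) ^ m"
      by (simp add: nu_num_def coeff_digit_poly to_int_of_nat_mod_ring flip: sum_digits)
    then have "nu_num m (digit_poly k :: 'p mod_ring poly) = k"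
      using k by simp
    moreover have "degree (digit_poly k :: 'p mod_ring poly) < m"
    proof -
      have "poly.coeff (digit_poly k :: 'p mod_ring poly) i = 0" if "i > m - 1" for i
      proof -
        have "CARD('p) ^ m \<le> CARD('p) ^ i"
          using that by (intro power_increasing) (auto simp: Suc_le_eq)
        with k show ?thesis
          by (simp add: coeff_digit_poly)
      qed
      then have "degree (digit_poly k :: 'p mod_ring poly) \<le> m - 1"
        by (intro degree_le) auto
      with assms show ?thesis by simp
    qed
    ultimately show "k \<in> nu_num m ` {f :: 'p mod_ring poly. degree f < m}"
      by (metis (mono_tags, lifting) image_eqI mem_Collect_eq)
  qed (auto simp: nu_num_bound)
qed

lemma finite_degree_less: "1 \<le> m \<Longrightarrow> finite {f :: 'p::prime_card mod_ring poly. degree f < m}"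
  using bij_betw_finite[OF bij_betw_nu_num] by blast

lemma card_degree_less: "1 \<le> m \<Longrightarrow> card {f :: 'p::prime_card mod_ring poly. degree f < m} = CARD('p) ^ m"
  using bij_betw_same_card[OF bij_betw_nu_num] by simp

section \<open>Walsh functions at the values of nu\<close>

lemma norm_wal [simp]: "norm (wal b h y) = 1"
proof -
  have "wal b h y = cis (2 * pi * of_int (\<Sum>i\<le>psi b h. int (h div b ^ i mod b) * (\<lfloor>real b ^ Suc i * y\<rfloor> mod int b)) / of_nat b)"
    by (simp add: wal_def cis_conv_exp mult_ac)
  then show ?thesis by simp
qed

lemma nu_digit:
  fixes f :: "'p::prime_card mod_ring poly"
  shows "of_int (\<lfloor>real CARD('p) ^ Suc i * nu m f\<rfloor> mod int CARD('p)) =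
     (if i < m then poly.coeff f (m - Suc i) else 0)"
proof (cases "i < m")
  case True
  let ?b = "CARD('p)"
  have "real ?b ^ m = real ?b ^ (m - Suc i) * real ?b ^ Suc i"
    using True by (subst power_add[symmetric]) simp
  then have "real ?b ^ Suc i * nu m f = real (nu_num m f) / real (?b ^ (m - Suc i))"
    by (simp add: nu_eq field_simps)
  then have "\<lfloor>real ?b ^ Suc i * nu m f\<rfloor> mod int ?b = int (nu_num m f div ?b ^ (m - Suc i) mod ?b)"
    by (simp only: floor_divide_of_nat_eq zmod_int)
  also have "\<dots> = to_int_mod_ring (poly.coeff f (m - Suc i))"
    using True by (simp add: nu_num_digit to_int_mod_ring_bounds)
  finally show ?thesis
    using True by simp
next
  case False
  let ?b = "CARD('p)"
  have "real ?b ^ Suc i = real ?b ^ (i - m) * real ?b * real ?b ^ m"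
    using False by (simp add: power_add[symmetric])
  then have "real ?b ^ Suc i * nu m f = of_int (int ?b * int (?b ^ (i - m) * nu_num m f))"
    by (simp add: nu_eq)
  then show ?thesis
    using False by (simp only: floor_of_int) simp
qed

text \<open>The digit reversal in \<open>nu\<close> pairs digit i of h with coefficient m - 1 - i of
  f, so the exponent of the Walsh function is a convolution, that is, one coefficient of a product
  of polynomials.\<close>

lemma wal_nu:
  fixes f :: "'p::prime_card mod_ring poly"
  assumes m: "1 \<le> m"
  shows "wal CARD('p) h (nu m f) = chi (poly.coeff (digit_poly h * f) (m - 1))"
proof -
  let ?b = "CARD('p)"
  define S where "S = (\<Sum>i\<le>psi ?b h. int (h div ?b ^ i mod ?b) * (\<lfloor>real ?b ^ Suc i * nu m f\<rfloor> mod int ?b))"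
  define t where "t i = of_nat (h div ?b ^ i) * (if i < m then poly.coeff f (m - Suc i) else 0)" for i
  have "wal ?b h (nu m f) = cis (2 * pi * of_int S / real ?b)"
    by (simp add: wal_def cis_conv_exp mult_ac S_def)
  also have "\<dots> = chi (of_int S :: 'p mod_ring)"
    by (simp add: chi_of_int)
  also have "(of_int S :: 'p mod_ring) = (\<Sum>i\<le>psi ?b h. t i)"
  proof -
    have "(of_nat (k mod ?b) :: 'p mod_ring) = of_nat k" for k
      using of_nat_mod_CHAR[where ?'a = "'p mod_ring"] by (simp only: semiring_char_mod_ring)
    then show ?thesis
      by (simp only: S_def of_int_sum of_int_mult nu_digit of_int_of_nat_eq t_def)
  qed
  \<comment> \<open>Either of \<open>psi\<close> and m - 1 may be the larger one. The range is
    extended past both and then cut at m - 1: the added terms vanish with the digits of h, the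
    removed ones with those of \<open>nu\<close>.\<close>
  also have "(\<Sum>i\<le>psi ?b h. t i) = (\<Sum>i\<le>psi ?b h + m. t i)"
  proof (rule sum.mono_neutral_left)
    show "\<forall>i\<in>{..psi ?b h + m} - {..psi ?b h}. t i = 0"
    proof
      fix i assume "i \<in> {..psi ?b h + m} - {..psi ?b h}"
      then have i: "Suc (psi ?b h) \<le> i" by auto
      have "h < ?b ^ i"
      proof (cases "h = 0")
        case False
        then have "h < ?b ^ Suc (psi ?b h)"
          using psi_bounds(2)[OF card_ge_2[where 'p = 'p], of h] by simp
        also have "\<dots> \<le> ?b ^ i"
          using i by (intro power_increasing) (auto simp: Suc_le_eq)
        finally show ?thesis .
      qed simp
      then show "t i = 0"
        by (simp add: t_def)
    qed
  qed auto
  also have "\<dots> = (\<Sum>i\<le>m - 1. t i)"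
    using m by (intro sum.mono_neutral_right) (auto simp: t_def)
  also have "\<dots> = poly.coeff (digit_poly h * f) (m - 1)"
    using m by (auto simp: coeff_mult coeff_digit_poly t_def intro!: sum.cong)
  finally show ?thesis .
qed

text \<open>If c has a non-zero coefficient at some v < m, a translation permutes the polynomials of
  degree below m and multiplies the sum by a root of unity other than 1, so the sum is 0.\<close>

lemma character_orthogonality:
  fixes c :: "'p::prime_card mod_ring poly"
  assumes m: "1 \<le> m"
  shows "(\<Sum>f | degree f < m. chi (poly.coeff (c * f) (m - 1))) =
    (if Polynomial.monom 1 m dvd c then of_nat (CARD('p) ^ m) else 0)"
proof (cases "Polynomial.monom 1 m dvd c")
  case True
  then have "poly.coeff (c * f) (m - 1) = 0" for f
    using m dvd_mult2[OF True, of f] unfolding monom_1_dvd_iff' by simp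
  with True show ?thesis
    by (simp add: card_degree_less[OF m])
next
  case False
  then obtain v where v: "v < m" "poly.coeff c v \<noteq> 0"
    by (auto simp: monom_1_dvd_iff')
  \<comment> \<open>The power of x that moves coefficient v of c to position m - 1.\<close>
  define f0 :: "'p mod_ring poly" where "f0 = Polynomial.monom 1 (m - 1 - v)"
  have f0: "poly.coeff (c * f0) (m - 1) = poly.coeff c v"
    using v by (simp add: f0_def coeff_monom_mult mult.commute[of c])
  have deg0: "degree f0 < m"
    using v by (simp add: f0_def degree_monom_eq)
  let ?S = "\<Sum>f | degree f < m. chi (poly.coeff (c * f) (m - 1))"
  have "?S = (\<Sum>f | degree f < m. chi (poly.coeff (c * (f + f0)) (m - 1)))"
    using deg0 degree_diff_less degree_add_less
    by (intro sum.reindex_bij_witness[of _ "\<lambda>f. f + f0" "\<lambda>f. f - f0"]) auto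
  also have "\<dots> = chi (poly.coeff c v) * ?S"
    by (simp only: distrib_left coeff_add chi_add f0 sum_distrib_left mult.commute[of _ "chi (poly.coeff c v)"])
  finally have "(chi (poly.coeff c v) - 1) * ?S = 0"
    by (simp add: algebra_simps)
  with chi_eq_1D v(2) False show ?thesis
    by auto
qed

section \<open>Reproducing kernel Hilbert spaces\<close>

context rkhs
begin

definition kernel_section :: "'x \<Rightarrow> 'x \<Rightarrow> complex"
  where "kernel_section y = (\<lambda>x. if x \<in> X then K x y else 0)"

lemma kernel_section_mem: "y \<in> X \<Longrightarrow> kernel_section y \<in> H"
  unfolding kernel_section_def by (rule kernel_mem)

lemma ip_kernel_section: "f \<in> H \<Longrightarrow> y \<in> X \<Longrightarrow> ip f (kernel_section y) = f y"
  unfolding kernel_section_def using reproducing by simp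

lemma diff_closed: "f \<in> H \<Longrightarrow> g \<in> H \<Longrightarrow> (\<lambda>x. f x - g x) \<in> H"
  using add_closed[of f "\<lambda>x. - 1 * g x"] scale_closed[of g "- 1"] by simp

lemma ip_diff: "f \<in> H \<Longrightarrow> g \<in> H \<Longrightarrow> k \<in> H \<Longrightarrow> ip (\<lambda>x. f x - g x) k = ip f k - ip g k"
  using ip_add[of f "\<lambda>x. - 1 * g x" k] ip_scale[of g k "- 1"] scale_closed[of g "- 1"] by simp

lemma ip_diff_right: "f \<in> H \<Longrightarrow> g \<in> H \<Longrightarrow> k \<in> H \<Longrightarrow> ip k (\<lambda>x. f x - g x) = ip k f - ip k g"
  using ip_conj[of "\<lambda>x. f x - g x" k] ip_diff[of f g k] diff_closed[of f g] ip_conj[of f k] ip_conj[of g k]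
  by simp

lemma ip_scale_right: "f \<in> H \<Longrightarrow> g \<in> H \<Longrightarrow> ip g (\<lambda>x. c * f x) = cnj c * ip g f"
  using ip_conj[of "\<lambda>x. c * f x" g] ip_scale[of f g c] scale_closed[of f c] ip_conj[of f g] by simp

lemma ip_zero: "f \<in> H \<Longrightarrow> ip f (\<lambda>x. 0) = 0"
  using ip_scale_right[of f f 0] by simp

lemma ip_zero_left: "f \<in> H \<Longrightarrow> ip (\<lambda>x. 0) f = 0"
  using ip_scale[of f f 0] by simp

lemma ip_add_right: "f \<in> H \<Longrightarrow> g \<in> H \<Longrightarrow> k \<in> H \<Longrightarrow> ip k (\<lambda>x. f x + g x) = ip k f + ip k g"
  using ip_conj[of "\<lambda>x. f x + g x" k] ip_add[of f g k] add_closed[of f g] ip_conj[of f k] ip_conj[of g k]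
  by simp

lemma sum_closed: "finite I \<Longrightarrow> (\<And>i. i \<in> I \<Longrightarrow> F i \<in> H) \<Longrightarrow> (\<lambda>x. \<Sum>i\<in>I. F i x) \<in> H"
  by (induction I rule: finite_induct) (auto simp: zero_closed add_closed)

lemma ip_sum_right:
  "finite I \<Longrightarrow> (\<And>i. i \<in> I \<Longrightarrow> F i \<in> H) \<Longrightarrow> f \<in> H \<Longrightarrow> ip f (\<lambda>x. \<Sum>i\<in>I. F i x) = (\<Sum>i\<in>I. ip f (F i))"
proof (induction I rule: finite_induct)
  case (insert i I)
  have S: "(\<lambda>x. \<Sum>i\<in>I. F i x) \<in> H" "F i \<in> H"
    using insert by (auto intro: sum_closed)
  have "ip f (\<lambda>x. F i x + (\<Sum>i\<in>I. F i x)) = ip f (F i) + ip f (\<lambda>x. \<Sum>i\<in>I. F i x)"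
    by (rule ip_add_right[OF S(2,1) insert.prems(2)])
  with insert show ?case by simp
qed (simp add: ip_zero)

lemma ip_norm_nonneg: "f \<in> H \<Longrightarrow> 0 \<le> ip_norm ip f"
  by (simp add: ip_norm_def ip_nonneg)

lemma ip_self: "f \<in> H \<Longrightarrow> ip f f = of_real ((ip_norm ip f)\<^sup>2)"
  using arg_cong[where f = Im, OF ip_conj[of f f]] ip_nonneg[of f] by (simp add: ip_norm_def complex_eq_iff)

lemma cauchy_schwarz:
  assumes f: "f \<in> H" and g: "g \<in> H"
  shows "cmod (ip f g) \<le> ip_norm ip f * ip_norm ip g"
proof (cases "ip_norm ip g = 0")
  case True
  then have "g = (\<lambda>x. 0)"
    using ip_definite[OF g] ip_self[OF g] by simp
  then show ?thesis
    using True by (simp add: ip_zero f)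
next
  case False
  define n where "n = (ip_norm ip g)\<^sup>2"
  define c where "c = ip f g / of_real n"
  have n: "n > 0"
    using False by (simp add: n_def)
  have cg: "(\<lambda>x. c * g x) \<in> H" and fcg: "(\<lambda>x. f x - c * g x) \<in> H"
    using f g scale_closed diff_closed by auto
  have gf: "ip g f = cnj (ip f g)"
    using ip_conj[OF f g] .
  have "ip (\<lambda>x. f x - c * g x) (\<lambda>x. f x - c * g x) =
      ip f f - cnj c * ip f g - (c * ip g f - c * (cnj c * ip g g))"
    by (simp only: ip_diff[OF f cg fcg] ip_diff_right[OF f cg f] ip_diff_right[OF f cg cg]
        ip_scale[OF g f] ip_scale[OF g cg] ip_scale_right[OF g f] ip_scale_right[OF g g])
  also have "ip g g = of_real n"
    using ip_self[OF g] by (simp add: n_def)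
  also have "ip f f - cnj c * ip f g - (c * ip g f - c * (cnj c * of_real n)) =
      ip f f - of_real ((cmod (ip f g))\<^sup>2 / n)"
    using n by (simp add: c_def gf complex_norm_square[symmetric] field_simps of_real_power[symmetric] del: of_real_power)
  finally have "0 \<le> Re (ip f f) - (cmod (ip f g))\<^sup>2 / n"
    using ip_nonneg[OF fcg] by simp
  then have "(cmod (ip f g))\<^sup>2 \<le> (ip_norm ip f * ip_norm ip g)\<^sup>2"
    using n by (simp add: ip_self[OF f] n_def field_simps power_mult_distrib)
  then show ?thesis
    using f g ip_norm_nonneg by (meson mult_nonneg_nonneg power2_le_imp_le)
qed

text \<open>The supremum is attained: Cauchy-Schwarz bounds it, and z divided by its norm (or 0, if
  that norm is 0) reaches the bound.\<close>

lemma norm_representer: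
  assumes z: "z \<in> H" and L: "\<And>f. f \<in> H \<Longrightarrow> L f = ip f z"
  shows "(SUP f\<in>{f \<in> H. ip_norm ip f \<le> 1}. cmod (L f)) = ip_norm ip z"
proof (rule cSup_eq_maximum)
  show "ip_norm ip z \<in> (\<lambda>f. cmod (L f)) ` {f \<in> H. ip_norm ip f \<le> 1}"
  proof (cases "ip_norm ip z = 0")
    case True
    then show ?thesis
      using zero_closed by (intro image_eqI[of _ _ "\<lambda>x. 0"]) (auto simp: L ip_zero_left z ip_norm_def)
  next
    case False
    define c :: complex where "c = of_real (1 / ip_norm ip z)"
    define f where "f = (\<lambda>x. c * z x)"
    have f: "f \<in> H"
      using z scale_closed by (simp add: f_def)
    have "ip f f = c * cnj c * ip z z"
      using ip_scale[OF z f, of c] ip_scale_right[OF z z, of c] by (simp add: f_def)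
    also have "\<dots> = 1"
      using False by (simp add: c_def ip_self[OF z] power2_eq_square)
    finally have "ip_norm ip f = 1"
      by (simp add: ip_norm_def)
    moreover have "L f = c * ip z z"
      using L[OF f] ip_scale[OF z z, of c] by (simp add: f_def)
    then have "L f = of_real (ip_norm ip z)"
      using False by (simp add: c_def ip_self[OF z] power2_eq_square)
    ultimately show ?thesis
      using f ip_norm_nonneg[OF z] by (intro image_eqI[of _ _ f]) auto
  qed
next
  fix t assume "t \<in> (\<lambda>f. cmod (L f)) ` {f \<in> H. ip_norm ip f \<le> 1}"
  then obtain f where f: "f \<in> H" "ip_norm ip f \<le> 1" "t = cmod (ip f z)"
    using L by auto
  then have "t \<le> ip_norm ip f * ip_norm ip z"
    using cauchy_schwarz[OF f(1) z] by simp
  also have "\<dots> \<le> 1 * ip_norm ip z"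
    using f z ip_norm_nonneg by (intro mult_right_mono) auto
  finally show "t \<le> ip_norm ip z" by simp
qed

text \<open>Completeness yields only some norm limit k. Norm convergence implies weak convergence,
  and testing against kernel sections shows that k has the values of h. This is how an explicitly
  given function is recognized as a member of H.\<close>

lemma pointwise_limit_mem:
  assumes F: "\<And>n. F n \<in> H"
    and cauchy: "\<And>e. e > 0 \<Longrightarrow> \<exists>M. \<forall>i\<ge>M. \<forall>j\<ge>M. ip_norm ip (\<lambda>x. F i x - F j x) < e"
    and lim: "\<And>x. x \<in> X \<Longrightarrow> (\<lambda>n. F n x) \<longlonglongrightarrow> h x"
    and out: "\<And>x. x \<notin> X \<Longrightarrow> h x = 0"
  shows "h \<in> H" and "f \<in> H \<Longrightarrow> (\<lambda>n. ip f (F n)) \<longlonglongrightarrow> ip f h"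
proof -
  obtain k where k: "k \<in> H" and kl: "(\<lambda>n. ip_norm ip (\<lambda>x. F n x - k x)) \<longlonglongrightarrow> 0"
    using complete[OF F cauchy] by blast
  have weak: "(\<lambda>n. ip f (F n)) \<longlonglongrightarrow> ip f k" if f: "f \<in> H" for f
  proof -
    have "cmod (ip f (F n) - ip f k) \<le> ip_norm ip f * ip_norm ip (\<lambda>x. F n x - k x)" for n
      using cauchy_schwarz[OF f diff_closed[OF F k]] ip_diff_right[OF F k f] by simp
    then have "\<forall>\<^sub>F n in sequentially. cmod (ip f (F n) - ip f k) \<le> ip_norm ip f * ip_norm ip (\<lambda>x. F n x - k x)"
      by simp
    then have "(\<lambda>n. ip f (F n) - ip f k) \<longlonglongrightarrow> 0"
      by (rule Lim_null_comparison) (rule tendsto_mult_right_zero[OF kl])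
    then show ?thesis
      by (simp add: LIM_zero_iff)
  qed
  have "h = k"
  proof
    fix x
    show "h x = k x"
    proof (cases "x \<in> X")
      case True
      have "(\<lambda>n. cnj (ip (kernel_section x) (F n))) \<longlonglongrightarrow> cnj (ip (kernel_section x) k)"
        using weak[OF kernel_section_mem[OF True]] by (intro tendsto_cnj)
      moreover have "cnj (ip (kernel_section x) f) = f x" if "f \<in> H" for f
        using ip_conj[OF kernel_section_mem[OF True] that] ip_kernel_section[OF that True] by simp
      ultimately have "(\<lambda>n. F n x) \<longlonglongrightarrow> k x"
        using F k by simp
      with lim[OF True] show ?thesis
        using LIMSEQ_unique by blast
    qed (use out supported[OF k] in auto)
  qed
  with k weak show "h \<in> H" "f \<in> H \<Longrightarrow> (\<lambda>n. ip f (F n)) \<longlonglongrightarrow> ip f h"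
    by auto
qed

text \<open>The representer of the equal-weight rule with nodes p i, counted with
  multiplicity.\<close>

definition kernel_average :: "('i \<Rightarrow> 'x) \<Rightarrow> 'i set \<Rightarrow> 'x \<Rightarrow> complex"
  where "kernel_average p I = (\<lambda>x. \<Sum>i\<in>I. (1 / of_nat (card I)) * kernel_section (p i) x)"

lemma kernel_average_mem: "finite I \<Longrightarrow> p ` I \<subseteq> X \<Longrightarrow> kernel_average p I \<in> H"
  unfolding kernel_average_def by (intro sum_closed scale_closed kernel_section_mem) auto

lemma ip_kernel_average:
  assumes "finite I" "p ` I \<subseteq> X" "f \<in> H"
  shows "ip f (kernel_average p I) = (\<Sum>i\<in>I. f (p i)) / of_nat (card I)"
proof -
  have sec: "kernel_section (p i) \<in> H" "ip f (kernel_section (p i)) = f (p i)" if "i \<in> I" for i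
    using assms that by (auto intro!: kernel_section_mem ip_kernel_section)
  have "ip f (kernel_average p I) = (\<Sum>i\<in>I. ip f (\<lambda>x. (1 / of_nat (card I)) * kernel_section (p i) x))"
    unfolding kernel_average_def using assms sec by (intro ip_sum_right scale_closed) auto
  also have "\<dots> = (\<Sum>i\<in>I. f (p i) / of_nat (card I))"
    using assms sec by (intro sum.cong refl) (simp only: ip_scale_right, simp)
  finally show ?thesis
    by (simp add: sum_divide_distrib)
qed

lemma ip_kernel_averages:
  assumes "finite I" "p ` I \<subseteq> X" "finite J" "q ` J \<subseteq> X"
  shows "ip (kernel_average p I) (kernel_average q J) =
    (\<Sum>j\<in>J. \<Sum>i\<in>I. K (q j) (p i)) / (of_nat (card I) * of_nat (card J))"
proof -
  have "ip (kernel_average p I) (kernel_average q J) = (\<Sum>j\<in>J. kernel_average p I (q j)) / of_nat (card J)"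
    using assms by (intro ip_kernel_average kernel_average_mem) auto
  also have "(\<Sum>j\<in>J. kernel_average p I (q j)) = (\<Sum>j\<in>J. (\<Sum>i\<in>I. K (q j) (p i)) / of_nat (card I))"
    using assms by (intro sum.cong refl) (auto simp: kernel_average_def kernel_section_def sum_divide_distrib)
  finally show ?thesis
    by (simp add: sum_divide_distrib)
qed

text \<open>The difference of two point evaluations is represented by the difference of two
  sections. Members of H need not be continuous; this bound turns convergence of the kernel along a
  sequence of points into convergence of their values.\<close>

lemma pointwise_difference_bound:
  assumes f: "f \<in> H" and x: "x \<in> X" and y: "y \<in> X"
  shows "cmod (f x - f y) \<le> ip_norm ip f * sqrt (Re (K x x + K y y - K x y - K y x))"
proof -
  let ?g = "\<lambda>t. kernel_section x t - kernel_section y t"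
  have sec: "kernel_section x \<in> H" "kernel_section y \<in> H" "?g \<in> H"
    using x y kernel_section_mem diff_closed by auto
  have "cmod (f x - f y) = cmod (ip f ?g)"
    using sec f x y by (simp add: ip_diff_right ip_kernel_section)
  also have "\<dots> \<le> ip_norm ip f * ip_norm ip ?g"
    using f sec by (intro cauchy_schwarz)
  also have "ip ?g ?g = K x x + K y y - K x y - K y x"
    using sec x y by (simp add: ip_diff_right ip_kernel_section) (simp add: kernel_section_def)
  then have "ip_norm ip ?g = sqrt (Re (K x x + K y y - K x y - K y x))"
    by (simp add: ip_norm_def)
  finally show ?thesis .
qed

lemma pointwise_bound:
  assumes f: "f \<in> H" and x: "x \<in> X"
  shows "cmod (f x) \<le> ip_norm ip f * sqrt (Re (K x x))"
proof -
  have "cmod (f x) \<le> ip_norm ip f * ip_norm ip (kernel_section x)"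
    using cauchy_schwarz[OF f kernel_section_mem[OF x]] f x by (simp add: ip_kernel_section)
  also have "ip (kernel_section x) (kernel_section x) = K x x"
    using x by (simp add: ip_kernel_section kernel_section_mem) (simp add: kernel_section_def)
  then have "ip_norm ip (kernel_section x) = sqrt (Re (K x x))"
    by (simp add: ip_norm_def)
  finally show ?thesis .
qed

end

section \<open>The Walsh kernel\<close>

lemma has_sum_sum:
  fixes f :: "'i \<Rightarrow> 'a \<Rightarrow> 'b :: topological_comm_monoid_add"
  assumes "finite I" "\<And>i. i \<in> I \<Longrightarrow> (f i has_sum s i) A"
  shows "((\<lambda>x. \<Sum>i\<in>I. f i x) has_sum (\<Sum>i\<in>I. s i)) A"
  using assms by (induction I rule: finite_induct) (auto intro: has_sum_add)

lemma summable_prod_PiE: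
  fixes f :: "'a \<Rightarrow> 'b :: countable \<Rightarrow> real"
  assumes "finite A" "\<And>x. x \<in> A \<Longrightarrow> f x summable_on B x" "\<And>x y. x \<in> A \<Longrightarrow> y \<in> B x \<Longrightarrow> 0 \<le> f x y"
  shows "(\<lambda>g. \<Prod>x\<in>A. f x (g x)) summable_on PiE A B"
proof -
  have "Infinite_Set_Sum.abs_summable_on (\<lambda>g. \<Prod>x\<in>A. f x (g x)) (PiE A B)"
    using assms by (intro abs_summable_on_prod_PiE)
      (auto simp: abs_summable_equivalent[symmetric] cong: summable_on_cong)
  then have "(\<lambda>g. norm (\<Prod>x\<in>A. f x (g x))) summable_on PiE A B"
    by (simp only: abs_summable_equivalent[symmetric])
  then show ?thesis
    by (rule abs_summable_summable)
qed

lemma walsh_weight_summable: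
  assumes "2 \<le> b" "\<beta> > 1" "A \<subseteq> {1..}"
  shows "walsh_weight b \<beta> summable_on A"
  using has_sum_mu[OF assms(1,2)] summable_on_subset[OF _ assms(3)] has_sum_imp_summable by blast

definition walsh_term :: "nat \<Rightarrow> real \<Rightarrow> real \<Rightarrow> real \<Rightarrow> nat \<Rightarrow> complex"
  where "walsh_term b \<alpha> x y h = of_real (walsh_weight b \<alpha> h) * wal b h x * cnj (wal b h y)"

definition walsh_kernel1 :: "nat \<Rightarrow> real \<Rightarrow> real \<Rightarrow> real \<Rightarrow> complex"
  where "walsh_kernel1 b \<alpha> x y = infsum (walsh_term b \<alpha> x y) {1..}"

lemma norm_walsh_term: "norm (walsh_term b \<alpha> x y h) = walsh_weight b \<alpha> h"
  by (simp add: walsh_term_def norm_mult)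

lemma walsh_term_summable:
  assumes "2 \<le> b" "\<alpha> > 1" "A \<subseteq> {1..}"
  shows "walsh_term b \<alpha> x y summable_on A"
  by (rule abs_summable_summable) (simp add: norm_walsh_term walsh_weight_summable[OF assms])

lemma has_sum_walsh_kernel1:
  assumes "2 \<le> b" "\<alpha> > 1"
  shows "(walsh_term b \<alpha> x y has_sum walsh_kernel1 b \<alpha> x y) {1..}"
  unfolding walsh_kernel1_def by (rule has_sum_infsum[OF walsh_term_summable[OF assms order_refl]])

lemma wal_mult_cnj: "wal b h x * cnj (wal b h x) = 1"
  by (simp add: complex_norm_square[symmetric])

lemma walsh_kernel1_diag:
  assumes "2 \<le> b" "\<alpha> > 1"
  shows "walsh_kernel1 b \<alpha> x x = of_real (mu b \<alpha>)"
proof -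
  have "((\<lambda>h. of_real (walsh_weight b \<alpha> h) :: complex) has_sum of_real (mu b \<alpha>)) {1..}"
    by (rule has_sum_of_real[OF has_sum_mu[OF assms]])
  also have "(\<lambda>h. of_real (walsh_weight b \<alpha> h)) = walsh_term b \<alpha> x x"
    by (simp add: fun_eq_iff walsh_term_def mult.assoc wal_mult_cnj)
  finally show ?thesis
    using has_sum_walsh_kernel1[OF assms] has_sum_unique by blast
qed

lemma cnj_walsh_kernel1: "cnj (walsh_kernel1 b \<alpha> x y) = walsh_kernel1 b \<alpha> y x"
  unfolding walsh_kernel1_def infsum_cnj[symmetric]
  by (rule infsum_cong) (simp add: walsh_term_def mult_ac)

text \<open>The terms have products of summable weights as moduli, and absolute convergence lets the
  multiple series factor into one-dimensional ones.\<close>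

lemma walsh_kernel_product:
  assumes "2 \<le> b" "\<alpha> > 1"
  shows "walsh_kernel b d \<alpha> \<gamma> x y =
    1 + (\<Sum>u\<in>Pow {1..d} - {{}}. of_real (\<gamma> u) * (\<Prod>j\<in>u. walsh_kernel1 b \<alpha> (x j) (y j)))"
proof -
  have "(\<Sum>\<^sub>\<infinity>h\<in>u \<rightarrow>\<^sub>E {1..}. (\<Prod>j\<in>u. wal b (h j) (x j)) * cnj (\<Prod>j\<in>u. wal b (h j) (y j)) /
            of_real (\<Prod>j\<in>u. real b powr (\<alpha> * real (psi b (h j))))) =
        (\<Prod>j\<in>u. walsh_kernel1 b \<alpha> (x j) (y j))" if "u \<in> Pow {1..d} - {{}}" for u
  proof -
    have "finite u"
      using that by (auto intro: finite_subset)
    have "(\<Sum>\<^sub>\<infinity>h\<in>u \<rightarrow>\<^sub>E {1..}. (\<Prod>j\<in>u. wal b (h j) (x j)) * cnj (\<Prod>j\<in>u. wal b (h j) (y j)) /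
            of_real (\<Prod>j\<in>u. real b powr (\<alpha> * real (psi b (h j))))) =
        (\<Sum>\<^sub>\<infinity>h\<in>u \<rightarrow>\<^sub>E {1..}. \<Prod>j\<in>u. walsh_term b \<alpha> (x j) (y j) (h j))"
      by (rule infsum_cong)
        (simp add: walsh_term_def walsh_weight_def powr_minus prod.distrib divide_inverse prod_inversef[symmetric] mult_ac)
    also have "\<dots> = (\<Prod>j\<in>u. infsum (walsh_term b \<alpha> (x j) (y j)) {1..})"
      by (rule infsum_prod_PiE_abs[OF \<open>finite u\<close>]) (simp add: norm_walsh_term walsh_weight_summable[OF assms])
    finally show ?thesis
      by (simp add: walsh_kernel1_def)
  qed
  then show ?thesis
    by (simp add: walsh_kernel_def)
qed

lemma cnj_walsh_kernel:
  assumes "2 \<le> b" "\<alpha> > 1"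
  shows "cnj (walsh_kernel b d \<alpha> \<gamma> x y) = walsh_kernel b d \<alpha> \<gamma> y x"
  by (simp add: walsh_kernel_product[OF assms] cnj_walsh_kernel1)

section \<open>Truncated digit expansions\<close>

definition trunc :: "nat \<Rightarrow> nat \<Rightarrow> real \<Rightarrow> real"
  where "trunc b n y = of_int \<lfloor>real b ^ n * y\<rfloor> / real b ^ n"

text \<open>The Walsh function of index h reads only the first \<open>psi b h\<close> + 1 digits,
  and truncation after n digits keeps them.\<close>

lemma wal_trunc:
  assumes b: "2 \<le> b" and h: "psi b h < n"
  shows "wal b h (trunc b n y) = wal b h y"
proof -
  have "\<lfloor>real b ^ Suc i * trunc b n y\<rfloor> = \<lfloor>real b ^ Suc i * y\<rfloor>" if "i \<le> psi b h" for i
  proof -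
    have "n = (n - Suc i) + Suc i"
      using that h by simp
    then have pw: "real b ^ n = real b ^ (n - Suc i) * real b ^ Suc i"
      by (metis power_add)
    have "real b ^ Suc i * trunc b n y = of_int \<lfloor>real b ^ n * y\<rfloor> / real_of_int (int b ^ (n - Suc i))"
      using b by (simp only: trunc_def pw) (simp add: field_simps)
    then have "\<lfloor>real b ^ Suc i * trunc b n y\<rfloor> = \<lfloor>real b ^ n * y\<rfloor> div int b ^ (n - Suc i)"
      by (simp only: floor_divide_real_eq_div floor_of_int zero_le_power of_nat_0_le_iff)
    also have "\<dots> = \<lfloor>(real b ^ n * y) / real_of_int (int b ^ (n - Suc i))\<rfloor>"
      by (subst floor_divide_real_eq_div) auto
    also have "(real b ^ n * y) / real_of_int (int b ^ (n - Suc i)) = real b ^ Suc i * y"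
      using b by (simp only: pw) (simp add: field_simps)
    finally show ?thesis .
  qed
  then show ?thesis
    unfolding wal_def by simp
qed

text \<open>Each term eventually equals the diagonal term, and the weights dominate, so Tannery's
  theorem applies. Walsh functions jump at b-adic rationals, so it matters that the points are
  truncations: convergence of the points as real numbers would not give this limit.\<close>

lemma walsh_kernel1_trunc_tendsto:
  assumes b: "2 \<le> b" and \<alpha>: "\<alpha> > 1"
  shows "(\<lambda>n. walsh_kernel1 b \<alpha> y (trunc b n y)) \<longlonglongrightarrow> of_real (mu b \<alpha>)"
proof -
  have sums: "(\<lambda>h. walsh_term b \<alpha> y z (Suc h)) sums walsh_kernel1 b \<alpha> y z" for z
  proof -
    have "(walsh_term b \<alpha> y z has_sum walsh_kernel1 b \<alpha> y z) {1..} \<longleftrightarrow>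
        ((\<lambda>h. walsh_term b \<alpha> y z (Suc h)) has_sum walsh_kernel1 b \<alpha> y z) UNIV"
      by (rule has_sum_reindex_bij_witness[of _ Suc "\<lambda>h. h - 1"]) auto
    then show ?thesis
      using has_sum_walsh_kernel1[OF assms] has_sum_imp_sums by blast
  qed
  have "(walsh_weight b \<alpha> has_sum mu b \<alpha>) {1..} \<longleftrightarrow> ((\<lambda>h. walsh_weight b \<alpha> (Suc h)) has_sum mu b \<alpha>) UNIV"
    by (rule has_sum_reindex_bij_witness[of _ Suc "\<lambda>h. h - 1"]) auto
  then have "summable (\<lambda>h. walsh_weight b \<alpha> (Suc h))"
    using has_sum_mu[OF assms] has_sum_imp_sums sums_summable by blast
  moreover have "(\<lambda>n. walsh_term b \<alpha> y (trunc b n y) (Suc h)) \<longlonglongrightarrow> walsh_term b \<alpha> y y (Suc h)" for h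
  proof (rule tendsto_eventually)
    show "\<forall>\<^sub>F n in sequentially. walsh_term b \<alpha> y (trunc b n y) (Suc h) = walsh_term b \<alpha> y y (Suc h)"
      using eventually_gt_at_top[of "psi b (Suc h)"]
      by eventually_elim (simp add: walsh_term_def wal_trunc[OF b])
  qed
  ultimately have "(\<lambda>n. \<Sum>h. walsh_term b \<alpha> y (trunc b n y) (Suc h)) \<longlonglongrightarrow> (\<Sum>h. walsh_term b \<alpha> y y (Suc h))"
    by (intro conjunct2[OF conjunct2[OF tannerys_theorem[where M = "\<lambda>h. walsh_weight b \<alpha> (Suc h)"]]])
      (auto simp: norm_walsh_term split_def)
  then show ?thesis
    using sums by (simp add: sums_iff walsh_kernel1_diag[OF assms])
qed

section \<open>Averages of the kernel over b-adic grids\<close>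

definition grid_mean :: "'p::prime_card itself \<Rightarrow> real \<Rightarrow> nat \<Rightarrow> real \<Rightarrow> complex"
  where "grid_mean _ \<alpha> n t =
    (\<Sum>f | degree (f :: 'p mod_ring poly) < n. walsh_kernel1 CARD('p) \<alpha> t (nu n f)) / of_nat (CARD('p) ^ n)"

lemma mean_wal_grid:
  assumes n: "1 \<le> n"
  shows "(\<Sum>f | degree (f :: 'p::prime_card mod_ring poly) < n. wal CARD('p) h (nu n f)) =
    of_nat (CARD('p) ^ n) * of_bool (CARD('p) ^ n dvd h)"
  using character_orthogonality[OF n, of "digit_poly h :: 'p mod_ring poly"]
  by (simp add: wal_nu[OF n] dvd_digit_poly_iff)

text \<open>Orthogonality removes every frequency not divisible by b^n; the total weight of the
  others is of order b^(-\<alpha>n), whence the convergence to 0.\<close>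

lemma grid_mean_has_sum:
  assumes \<alpha>: "\<alpha> > 1" and n: "1 \<le> n"
  shows "((\<lambda>h. of_real (walsh_weight CARD('p) \<alpha> h) * wal CARD('p) h t) has_sum grid_mean TYPE('p::prime_card) \<alpha> n t)
    {h. 1 \<le> h \<and> CARD('p) ^ n dvd h}"
proof -
  let ?b = "CARD('p)"
  let ?P = "{f :: 'p mod_ring poly. degree f < n}"
  note b = card_ge_2[where 'p = 'p]
  have "((\<lambda>h. \<Sum>f\<in>?P. walsh_term ?b \<alpha> t (nu n f) h) has_sum (\<Sum>f\<in>?P. walsh_kernel1 ?b \<alpha> t (nu n f))) {1..}"
    by (intro has_sum_sum finite_degree_less n has_sum_walsh_kernel1 b \<alpha>)
  then have "((\<lambda>h. (\<Sum>f\<in>?P. walsh_term ?b \<alpha> t (nu n f) h) * (1 / of_nat (?b ^ n))) has_sum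
      (\<Sum>f\<in>?P. walsh_kernel1 ?b \<alpha> t (nu n f)) * (1 / of_nat (?b ^ n))) {1..}"
    by (rule has_sum_cmult_left)
  also have "(\<lambda>h. (\<Sum>f\<in>?P. walsh_term ?b \<alpha> t (nu n f) h) * (1 / of_nat (?b ^ n))) =
      (\<lambda>h. of_real (walsh_weight ?b \<alpha> h) * wal ?b h t * of_bool (?b ^ n dvd h))"
  proof
    fix h
    have "(\<Sum>f\<in>?P. walsh_term ?b \<alpha> t (nu n f) h) =
        of_real (walsh_weight ?b \<alpha> h) * wal ?b h t * cnj (\<Sum>f\<in>?P. wal ?b h (nu n f))"
      by (simp add: walsh_term_def sum_distrib_left)
    then show "(\<Sum>f\<in>?P. walsh_term ?b \<alpha> t (nu n f) h) * (1 / of_nat (?b ^ n)) =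
        of_real (walsh_weight ?b \<alpha> h) * wal ?b h t * of_bool (?b ^ n dvd h)"
      by (simp add: mean_wal_grid[OF n])
  qed
  also have "(\<Sum>f\<in>?P. walsh_kernel1 ?b \<alpha> t (nu n f)) * (1 / of_nat (?b ^ n)) = grid_mean TYPE('p) \<alpha> n t"
    by (simp add: grid_mean_def)
  finally show ?thesis
    by (rule has_sum_cong_neutral[THEN iffD1, rotated -1]) auto
qed

lemma norm_grid_mean_le:
  assumes "\<alpha> > 1" "1 \<le> n"
  shows "norm (grid_mean TYPE('p::prime_card) \<alpha> n t) \<le> real CARD('p) powr (- \<alpha> * real n) * mu CARD('p) \<alpha>"
  using grid_mean_has_sum[OF assms] has_sum_multiples[OF card_ge_2 assms(1)]
  by (rule norm_infsum_le) (simp add: norm_mult)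

lemma powr_minus_tendsto_0:
  assumes "2 \<le> b" "\<alpha> > 0"
  shows "(\<lambda>n. real b powr (- \<alpha> * real n)) \<longlonglongrightarrow> 0"
proof -
  have "(\<lambda>n. (real b powr (- \<alpha>)) ^ n) \<longlonglongrightarrow> 0"
    using assms by (intro LIMSEQ_realpow_zero) (auto simp: powr_less_one)
  then show ?thesis
    using assms by (simp add: powr_realpow[symmetric] powr_powr)
qed

lemma grid_mean_tendsto:
  assumes "\<alpha> > 1"
  shows "(\<lambda>n. grid_mean TYPE('p::prime_card) \<alpha> (Suc n) t) \<longlonglongrightarrow> 0"
proof (rule Lim_null_comparison)
  show "\<forall>\<^sub>F n in sequentially. norm (grid_mean TYPE('p) \<alpha> (Suc n) t) \<le>
      real CARD('p) powr (- \<alpha> * real (Suc n)) * mu CARD('p) \<alpha>"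
    by (intro always_eventually allI norm_grid_mean_le assms) auto
  show "(\<lambda>n. real CARD('p) powr (- \<alpha> * real (Suc n)) * mu CARD('p) \<alpha>) \<longlonglongrightarrow> 0"
    using assms card_ge_2[where 'p = 'p]
    by (intro tendsto_mult_left_zero filterlim_compose[OF powr_minus_tendsto_0 filterlim_Suc]) auto
qed

text \<open>The surviving frequencies are multiples of b^n, and their Walsh functions equal 1 at all
  points of a grid that is not finer. Hence the mean has the same value at all these points.\<close>

lemma grid_mean_at_grid:
  fixes f :: "'p::prime_card mod_ring poly"
  assumes \<alpha>: "\<alpha> > 1" and k: "1 \<le> k" "k \<le> n"
  shows "grid_mean TYPE('p) \<alpha> n (nu k f) = of_real (real CARD('p) powr (- \<alpha> * real n) * mu CARD('p) \<alpha>)"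
proof -
  let ?b = "CARD('p)"
  have n: "1 \<le> n"
    using k by simp
  have "wal ?b h (nu k f) = 1" if "?b ^ n dvd h" for h
  proof -
    have "?b ^ k dvd h"
      using that k by (meson dvd_trans le_imp_power_dvd)
    then have "Polynomial.monom 1 k dvd (digit_poly h * f)"
      by (simp add: dvd_digit_poly_iff)
    with k show ?thesis
      by (simp add: wal_nu monom_1_dvd_iff')
  qed
  then have "((\<lambda>h. of_real (walsh_weight ?b \<alpha> h) :: complex) has_sum grid_mean TYPE('p) \<alpha> n (nu k f)) {h. 1 \<le> h \<and> ?b ^ n dvd h}"
    using grid_mean_has_sum[OF \<alpha> n, where 'p = 'p and t = "nu k f"]
    by (subst has_sum_cong) auto
  moreover have "((\<lambda>h. of_real (walsh_weight ?b \<alpha> h) :: complex) has_sum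
      of_real (real ?b powr (- \<alpha> * real n) * mu ?b \<alpha>)) {h. 1 \<le> h \<and> ?b ^ n dvd h}"
    by (rule has_sum_of_real[OF has_sum_multiples[OF card_ge_2 \<alpha>]])
  ultimately show ?thesis
    by (rule has_sum_unique)
qed

section \<open>The constant function in the Walsh space\<close>

definition grid_index :: "nat \<Rightarrow> nat \<Rightarrow> (nat \<Rightarrow> 'p::prime_card mod_ring poly) set"
  where "grid_index d n = {1..d} \<rightarrow>\<^sub>E {f. degree f < n}"

definition grid_point :: "nat \<Rightarrow> nat \<Rightarrow> (nat \<Rightarrow> 'p::prime_card mod_ring poly) \<Rightarrow> nat \<Rightarrow> real"
  where "grid_point d n f = (\<lambda>j\<in>{1..d}. nu n (f j))"

lemma zero_power_card: "u \<in> Pow {1..d} - {{}} \<Longrightarrow> 0 ^ card u = (0 :: 'a :: semiring_1)" for d :: nat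
  using finite_subset[of u "{1..d}"] by (auto simp: power_0_left)

lemma finite_grid_index: "1 \<le> n \<Longrightarrow> finite (grid_index d n)"
  unfolding grid_index_def by (intro finite_PiE finite_degree_less) auto

lemma card_grid_index:
  "1 \<le> n \<Longrightarrow> card (grid_index d n :: (nat \<Rightarrow> 'p::prime_card mod_ring poly) set) = (CARD('p) ^ n) ^ d"
  by (simp add: grid_index_def card_PiE card_degree_less)

lemma grid_point_mem: "grid_point d n f \<in> unit_cube d"
  by (simp add: grid_point_def unit_cube_def restrict_PiE_iff nu_in_unit_interval del: atLeastLessThan_iff)

text \<open>Over the full product grid, a sum of products over the coordinates in u factors; each
  coordinate outside u contributes b^n, which the normalization removes.\<close>

lemma walsh_kernel_grid_mean:
  assumes \<alpha>: "\<alpha> > 1" and n: "1 \<le> n"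
  shows "(\<Sum>f\<in>grid_index d n. walsh_kernel CARD('p) d \<alpha> \<gamma> x (grid_point d n (f :: nat \<Rightarrow> 'p::prime_card mod_ring poly)))
      / of_nat ((CARD('p) ^ n) ^ d) =
    1 + (\<Sum>u\<in>Pow {1..d} - {{}}. of_real (\<gamma> u) * (\<Prod>j\<in>u. grid_mean TYPE('p) \<alpha> n (x j)))"
proof -
  let ?b = "CARD('p)"
  let ?P = "{f :: 'p mod_ring poly. degree f < n}"
  let ?G = "grid_index d n :: (nat \<Rightarrow> 'p mod_ring poly) set"
  define N :: complex where "N = of_nat ((?b ^ n) ^ d)"
  have N: "N \<noteq> 0"
    by (simp add: N_def)
  have part: "(\<Sum>f\<in>?G. \<Prod>j\<in>u. walsh_kernel1 ?b \<alpha> (x j) (grid_point d n f j)) =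
      N * (\<Prod>j\<in>u. grid_mean TYPE('p) \<alpha> n (x j))" if u: "u \<subseteq> {1..d}" for u
  proof -
    have restrict: "(\<Prod>j\<in>{1..d}. if j \<in> u then F j else 1) = (\<Prod>j\<in>u. F j)" for F :: "nat \<Rightarrow> complex"
      using u by (subst prod.inter_restrict[symmetric]) (auto simp: Int_absorb1)
    have "(\<Sum>f\<in>?G. \<Prod>j\<in>u. walsh_kernel1 ?b \<alpha> (x j) (grid_point d n f j)) =
        (\<Sum>f\<in>?G. \<Prod>j\<in>{1..d}. if j \<in> u then walsh_kernel1 ?b \<alpha> (x j) (nu n (f j)) else 1)"
      by (intro sum.cong refl, subst restrict, rule prod.cong) (use u in \<open>auto simp: grid_point_def\<close>)
    also have "\<dots> = (\<Prod>j\<in>{1..d}. \<Sum>f\<in>?P. if j \<in> u then walsh_kernel1 ?b \<alpha> (x j) (nu n f) else 1)"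
      unfolding grid_index_def by (rule prod_sum_PiE[symmetric]) (auto intro: finite_degree_less n)
    also have "\<dots> = (\<Prod>j\<in>{1..d}. of_nat (?b ^ n) * (if j \<in> u then grid_mean TYPE('p) \<alpha> n (x j) else 1))"
      by (intro prod.cong refl) (auto simp: grid_mean_def card_degree_less[OF n])
    also have "\<dots> = N * (\<Prod>j\<in>u. grid_mean TYPE('p) \<alpha> n (x j))"
      by (simp only: prod.distrib restrict) (simp add: N_def)
    finally show ?thesis .
  qed
  have "(\<Sum>f\<in>?G. walsh_kernel ?b d \<alpha> \<gamma> x (grid_point d n f)) =
      N + (\<Sum>u\<in>Pow {1..d} - {{}}. of_real (\<gamma> u) * (\<Sum>f\<in>?G. \<Prod>j\<in>u. walsh_kernel1 ?b \<alpha> (x j) (grid_point d n f j)))"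
    unfolding walsh_kernel_product[OF card_ge_2 \<alpha>] sum.distrib sum_distrib_left
    by (subst sum.swap) (simp add: N_def card_grid_index[OF n])
  also have "\<dots> = N + (\<Sum>u\<in>Pow {1..d} - {{}}. of_real (\<gamma> u) * (N * (\<Prod>j\<in>u. grid_mean TYPE('p) \<alpha> n (x j))))"
    using part by (intro arg_cong2[where f = "(+)"] sum.cong refl) auto
  also have "\<dots> = N * (1 + (\<Sum>u\<in>Pow {1..d} - {{}}. of_real (\<gamma> u) * (\<Prod>j\<in>u. grid_mean TYPE('p) \<alpha> n (x j))))"
    by (simp add: distrib_left sum_distrib_left mult_ac)
  finally show ?thesis
    using N by (simp add: N_def)
qed

definition grid_cell :: "nat \<Rightarrow> 'p::prime_card mod_ring poly \<Rightarrow> real set"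
  where "grid_cell n f = {nu n f..<nu n f + 1 / real CARD('p) ^ n}"

lemma mem_grid_cell_iff:
  "t \<in> grid_cell n (f :: 'p::prime_card mod_ring poly) \<longleftrightarrow> \<lfloor>real CARD('p) ^ n * t\<rfloor> = int (nu_num n f)"
proof -
  have "t \<in> grid_cell n f \<longleftrightarrow> real (nu_num n f) \<le> real CARD('p) ^ n * t \<and> real CARD('p) ^ n * t < real (nu_num n f) + 1"
    by (simp add: grid_cell_def nu_eq field_simps)
  then show ?thesis
    by (simp add: floor_eq_iff)
qed

lemma grid_cell_subset: "grid_cell n (f :: 'p::prime_card mod_ring poly) \<subseteq> {0..<1}"
proof
  fix t assume t: "t \<in> grid_cell n f"
  let ?B = "real CARD('p) ^ n"
  have "real (nu_num n f) + 1 \<le> ?B"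
    using nu_num_bound[of n f] by (metis Suc_leI of_nat_Suc of_nat_le_iff of_nat_power add.commute)
  moreover have "real (nu_num n f) \<le> ?B * t" "?B * t < real (nu_num n f) + 1"
    using t by (auto simp: mem_grid_cell_iff floor_eq_iff)
  ultimately have "0 \<le> ?B * t" "?B * t < ?B * 1"
    by linarith+
  then show "t \<in> {0..<1}"
    using mult_le_cancel_left_pos[of ?B 0 t] mult_less_cancel_left_pos[of ?B t 1] by simp
qed

text \<open>The cell of t has numerator equal to the floor of b^n t, so existence and uniqueness
  both come from \<open>bij_betw_nu_num\<close>.\<close>

lemma ex1_grid_cell:
  assumes n: "1 \<le> n" and t: "t \<in> {0..<1}"
  shows "\<exists>f :: 'p::prime_card mod_ring poly. degree f < n \<and> nu n f = trunc CARD('p) n t \<and>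
    (\<forall>f'. degree f' < n \<longrightarrow> t \<in> grid_cell n f' \<longleftrightarrow> f' = f)"
proof -
  let ?B = "real CARD('p) ^ n"
  define k where "k = nat \<lfloor>?B * t\<rfloor>"
  have "?B * t < ?B"
    using t by simp
  then have "\<lfloor>?B * t\<rfloor> < int (CARD('p) ^ n)"
    by (simp add: floor_less_iff)
  moreover have k0: "0 \<le> \<lfloor>?B * t\<rfloor>"
    using t by simp
  ultimately have "k \<in> {..<CARD('p) ^ n}"
    by (simp add: k_def nat_less_iff)
  then obtain f :: "'p mod_ring poly" where f: "degree f < n" "nu_num n f = k"
    using bij_betw_nu_num[OF n, where 'p = 'p] unfolding bij_betw_def by (metis (mono_tags, lifting) imageE mem_Collect_eq)
  have k: "int k = \<lfloor>?B * t\<rfloor>"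
    using k0 by (simp add: k_def)
  have "nu n f = trunc CARD('p) n t"
    by (simp add: nu_eq trunc_def f k[symmetric])
  moreover have "t \<in> grid_cell n f' \<longleftrightarrow> f' = f" if "degree f' < n" for f' :: "'p mod_ring poly"
    using bij_betw_nu_num[OF n, where 'p = 'p] that f unfolding mem_grid_cell_iff k[symmetric] bij_betw_def inj_on_def
    by auto
  ultimately show ?thesis
    using f by blast
qed

locale walsh_rkhs = rkhs "unit_cube d" "walsh_kernel CARD('p::prime_card) d \<alpha> \<gamma>" H ip
  for p :: "'p::prime_card itself" and d :: nat and \<alpha> :: real and \<gamma> :: "nat set \<Rightarrow> real" and H ip +
  assumes \<alpha>: "\<alpha> > 1"
begin

definition one :: "(nat \<Rightarrow> real) \<Rightarrow> complex"
  where "one = (\<lambda>x. if x \<in> unit_cube d then 1 else 0)"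

text \<open>The shift to \<open>Suc n\<close> avoids resolution 0, for which the set of polynomials
  of degree below 0 would be empty.\<close>

definition grid_average :: "'p itself \<Rightarrow> nat \<Rightarrow> (nat \<Rightarrow> real) \<Rightarrow> complex"
  where "grid_average _ n = kernel_average (grid_point d (Suc n)) (grid_index d (Suc n) :: (nat \<Rightarrow> 'p mod_ring poly) set)"

lemma grid_average_mem: "grid_average p n \<in> H"
  unfolding grid_average_def by (intro kernel_average_mem finite_grid_index) (auto simp: grid_point_mem)

lemma ip_grid_average:
  assumes "f \<in> H"
  shows "ip f (grid_average p n) =
    (\<Sum>i\<in>grid_index d (Suc n). f (grid_point d (Suc n) (i :: nat \<Rightarrow> 'p mod_ring poly))) / of_nat ((CARD('p) ^ Suc n) ^ d)"
  unfolding grid_average_def using assms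
  by (subst ip_kernel_average) (auto simp: finite_grid_index grid_point_mem card_grid_index simp del: power_Suc)

lemma grid_average_eq:
  assumes "x \<in> unit_cube d"
  shows "grid_average p n x =
    1 + (\<Sum>u\<in>Pow {1..d} - {{}}. of_real (\<gamma> u) * (\<Prod>j\<in>u. grid_mean TYPE('p) \<alpha> (Suc n) (x j)))"
proof -
  have "grid_average p n x = (\<Sum>i\<in>grid_index d (Suc n). walsh_kernel CARD('p) d \<alpha> \<gamma> x (grid_point d (Suc n) (i :: nat \<Rightarrow> 'p mod_ring poly)))
      / of_nat ((CARD('p) ^ Suc n) ^ d)"
    using assms by (simp add: grid_average_def kernel_average_def kernel_section_def card_grid_index sum_divide_distrib
        del: power_Suc)
  then show ?thesis
    by (simp add: walsh_kernel_grid_mean[OF \<alpha>] del: power_Suc of_nat_power)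
qed

text \<open>The squared norm of the grid average, by \<open>ip_grid_averages\<close> with equal
  indices.\<close>

definition grid_energy :: "'p itself \<Rightarrow> nat \<Rightarrow> real"
  where "grid_energy _ n = 1 + (\<Sum>u\<in>Pow {1..d} - {{}}. \<gamma> u * (real CARD('p) powr (- \<alpha> * real (Suc n)) * mu CARD('p) \<alpha>) ^ card u)"

lemma grid_energy_tendsto: "grid_energy p \<longlonglongrightarrow> 1"
proof -
  have "(\<lambda>n. real CARD('p) powr (- \<alpha> * real (Suc n)) * mu CARD('p) \<alpha>) \<longlonglongrightarrow> 0"
    using \<alpha> card_ge_2[where 'p = 'p]
    by (intro tendsto_mult_left_zero filterlim_compose[OF powr_minus_tendsto_0 filterlim_Suc]) auto
  then have "grid_energy p \<longlonglongrightarrow> 1 + (\<Sum>u\<in>Pow {1..d} - {{}}. \<gamma> u * 0 ^ card u)"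
    unfolding grid_energy_def by (intro tendsto_intros)
  also have "(\<Sum>u\<in>Pow {1..d} - {{}}. \<gamma> u * 0 ^ card u) = 0"
    by (intro sum.neutral ballI) (simp only: zero_power_card prod_constant mult_zero_right)
  finally show ?thesis by simp
qed

text \<open>The finer of two nested grids integrates the kernel sections of the coarser one in the same way.\<close>

lemma ip_grid_averages_aux:
  assumes "m \<le> n"
  shows "ip (grid_average p n) (grid_average p m) = of_real (grid_energy p n)"
proof -
  let ?G = "grid_index d (Suc m) :: (nat \<Rightarrow> 'p mod_ring poly) set"
  have "grid_average p n (grid_point d (Suc m) i) = of_real (grid_energy p n)" for i :: "nat \<Rightarrow> 'p mod_ring poly"
  proof -
    have "(\<Prod>j\<in>u. grid_mean TYPE('p) \<alpha> (Suc n) (grid_point d (Suc m) i j)) =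
        of_real ((real CARD('p) powr (- \<alpha> * real (Suc n)) * mu CARD('p) \<alpha>) ^ card u)" if "u \<subseteq> {1..d}" for u
    proof -
      have "(\<Prod>j\<in>u. grid_mean TYPE('p) \<alpha> (Suc n) (grid_point d (Suc m) i j)) =
          (\<Prod>j\<in>u. of_real (real CARD('p) powr (- \<alpha> * real (Suc n)) * mu CARD('p) \<alpha>))"
      proof (rule prod.cong)
        fix j assume "j \<in> u"
        then have "grid_point d (Suc m) i j = nu (Suc m) (i j)"
          using that by (auto simp: grid_point_def)
        then show "grid_mean TYPE('p) \<alpha> (Suc n) (grid_point d (Suc m) i j) = of_real (real CARD('p) powr (- \<alpha> * real (Suc n)) * mu CARD('p) \<alpha>)"
          using grid_mean_at_grid[OF \<alpha>, of "Suc m" "Suc n" "i j"] assms by simp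
      qed simp
      then show ?thesis by simp
    qed
    then show ?thesis
      unfolding grid_average_eq[OF grid_point_mem] grid_energy_def by simp
  qed
  then have "ip (grid_average p n) (grid_average p m) = of_nat (card ?G) * of_real (grid_energy p n) / of_nat ((CARD('p) ^ Suc m) ^ d)"
    by (simp add: ip_grid_average[OF grid_average_mem] del: power_Suc of_nat_power)
  then show ?thesis
    by (simp add: card_grid_index del: power_Suc)
qed

lemma ip_grid_averages: "ip (grid_average p m) (grid_average p n) = of_real (grid_energy p (max m n))"
proof (cases "m \<le> n")
  case True
  then have "ip (grid_average p m) (grid_average p n) = cnj (of_real (grid_energy p n))"
    using ip_conj[OF grid_average_mem grid_average_mem, of n m] ip_grid_averages_aux by simp
  with True show ?thesis
    by (simp add: max_def)
qed (simp add: ip_grid_averages_aux max_def)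

lemma norm_grid_average_diff:
  "ip_norm ip (\<lambda>x. grid_average p i x - grid_average p j x) = sqrt \<bar>grid_energy p i - grid_energy p j\<bar>"
proof -
  have mem: "(\<lambda>x. grid_average p i x - grid_average p j x) \<in> H"
    by (intro diff_closed grid_average_mem)
  have "ip (\<lambda>x. grid_average p i x - grid_average p j x) (\<lambda>x. grid_average p i x - grid_average p j x) =
      of_real (grid_energy p i + grid_energy p j - 2 * grid_energy p (max i j))"
    by (simp add: ip_diff ip_diff_right grid_average_mem mem ip_grid_averages max.commute)
  then have eq: "Re (ip (\<lambda>x. grid_average p i x - grid_average p j x) (\<lambda>x. grid_average p i x - grid_average p j x)) =
      grid_energy p i + grid_energy p j - 2 * grid_energy p (max i j)"
    by simp
  \<comment> \<open>The expansion is the difference of the two energies up to sign; a squared norm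
    is nonnegative, and this settles the sign.\<close>
  with ip_nonneg[OF mem] have "0 \<le> grid_energy p i + grid_energy p j - 2 * grid_energy p (max i j)"
    by simp
  then have "grid_energy p i + grid_energy p j - 2 * grid_energy p (max i j) = \<bar>grid_energy p i - grid_energy p j\<bar>"
    by (auto simp: max_def)
  with eq show ?thesis
    by (simp add: ip_norm_def)
qed

lemma grid_average_cauchy:
  assumes "e > 0"
  shows "\<exists>M. \<forall>i\<ge>M. \<forall>j\<ge>M. ip_norm ip (\<lambda>x. grid_average p i x - grid_average p j x) < e"
proof -
  have "Cauchy (grid_energy p)"
    using grid_energy_tendsto by (intro LIMSEQ_imp_Cauchy)
  then obtain M where M: "\<And>i j. i \<ge> M \<Longrightarrow> j \<ge> M \<Longrightarrow> dist (grid_energy p i) (grid_energy p j) < e\<^sup>2"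
    using assms by (metis Cauchy_def zero_less_power)
  have "sqrt \<bar>grid_energy p i - grid_energy p j\<bar> < e" if "i \<ge> M" "j \<ge> M" for i j
    using M[OF that] assms by (intro real_less_lsqrt) (auto simp: dist_real_def)
  then show ?thesis
    by (auto simp: norm_grid_average_diff)
qed

lemma grid_average_tendsto:
  assumes "x \<in> unit_cube d"
  shows "(\<lambda>n. grid_average p n x) \<longlonglongrightarrow> one x"
proof -
  have "(\<lambda>n. grid_average p n x) \<longlonglongrightarrow> 1 + (\<Sum>u\<in>Pow {1..d} - {{}}. of_real (\<gamma> u) * (\<Prod>j\<in>u. 0))"
    unfolding grid_average_eq[OF assms] by (intro tendsto_intros grid_mean_tendsto \<alpha>)
  also have "(\<Sum>u\<in>Pow {1..d} - {{}}. of_real (\<gamma> u) * (\<Prod>j\<in>u. 0 :: complex)) = 0"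
    by (intro sum.neutral ballI) (simp only: zero_power_card prod_constant mult_zero_right)
  finally show ?thesis
    using assms by (simp add: one_def)
qed

lemma one_mem: "one \<in> H"
  by (rule pointwise_limit_mem(1)[OF grid_average_mem grid_average_cauchy grid_average_tendsto]) (auto simp: one_def)

lemma ip_grid_average_tendsto: "f \<in> H \<Longrightarrow> (\<lambda>n. ip f (grid_average p n)) \<longlonglongrightarrow> ip f one"
  by (rule pointwise_limit_mem(2)[OF grid_average_mem grid_average_cauchy grid_average_tendsto]) (auto simp: one_def)

lemma ip_one_one: "ip one one = 1"
proof -
  \<comment> \<open>Every grid rule is exact for the constant 1, so the sequence that tends to
    \<open>ip one one\<close> is constant.\<close>
  have "ip one (grid_average p n) = 1" for n
    unfolding ip_grid_average[OF one_mem] by (simp add: one_def grid_point_mem card_grid_index del: power_Suc)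
  then have "(\<lambda>n. 1) \<longlonglongrightarrow> ip one one"
    using ip_grid_average_tendsto[OF one_mem] by simp
  then show ?thesis
    using LIMSEQ_unique tendsto_const by blast
qed

end

section \<open>Integration\<close>

text \<open>Takes on each cell the value of f at the lower corner. Only finitely many values of f
  enter, so it is measurable whatever f is, and its integral is a grid average.\<close>

definition step_function ::
  "'p::prime_card itself \<Rightarrow> nat \<Rightarrow> nat \<Rightarrow> ((nat \<Rightarrow> real) \<Rightarrow> complex) \<Rightarrow> (nat \<Rightarrow> real) \<Rightarrow> complex" where
  "step_function _ d n f x = (\<Sum>i\<in>grid_index d n.
     (\<Prod>j\<in>{1..d}. indicator (grid_cell n (i j :: 'p mod_ring poly)) (x j) :: real) *\<^sub>R f (grid_point d n i))"

definition trunc_point :: "nat \<Rightarrow> nat \<Rightarrow> nat \<Rightarrow> (nat \<Rightarrow> real) \<Rightarrow> nat \<Rightarrow> real"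
  where "trunc_point b d n x = (\<lambda>j\<in>{1..d}. trunc b n (x j))"

lemma step_function_eq:
  assumes n: "1 \<le> n" and x: "x \<in> unit_cube d"
  shows "step_function TYPE('p::prime_card) d n f x = f (trunc_point CARD('p) d n x)"
    and "trunc_point CARD('p) d n x \<in> unit_cube d"
proof -
  have xj: "x j \<in> {0..<1}" if "j \<in> {1..d}" for j
    using x that by (auto simp: unit_cube_def)
  have "\<exists>f :: 'p mod_ring poly. j \<in> {1..d} \<longrightarrow> degree f < n \<and> nu n f = trunc CARD('p) n (x j) \<and>
      (\<forall>f'. degree f' < n \<longrightarrow> x j \<in> grid_cell n f' \<longleftrightarrow> f' = f)" for j
    using ex1_grid_cell[OF n xj[of j], where 'p = 'p] by blast
  then obtain i :: "nat \<Rightarrow> 'p mod_ring poly" where i: "\<And>j. j \<in> {1..d} \<Longrightarrow> degree (i j) < n \<and>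
      nu n (i j) = trunc CARD('p) n (x j) \<and> (\<forall>f'. degree f' < n \<longrightarrow> x j \<in> grid_cell n f' \<longleftrightarrow> f' = i j)"
    by metis
  define i0 where "i0 = restrict i {1..d}"
  have i0: "i0 \<in> grid_index d n"
    using i by (auto simp: i0_def grid_index_def)
  have pt: "grid_point d n i0 = trunc_point CARD('p) d n x"
    using i by (auto simp: fun_eq_iff grid_point_def trunc_point_def i0_def)
  then show "trunc_point CARD('p) d n x \<in> unit_cube d"
    using grid_point_mem by metis
  \<comment> \<open>Exactly one cell of the product grid contains x, so the sum collapses to the
    index \<open>i0\<close>.\<close>
  have "(\<Prod>j\<in>{1..d}. indicator (grid_cell n (k j)) (x j) :: real) = (if k = i0 then 1 else 0)"
    if k: "k \<in> grid_index d n" for k :: "nat \<Rightarrow> 'p mod_ring poly"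
  proof (cases "k = i0")
    case True
    then have "x j \<in> grid_cell n (k j)" if "j \<in> {1..d}" for j
      using i[OF that] that by (auto simp: i0_def)
    with True show ?thesis
      by (simp add: indicator_def)
  next
    case False
    then obtain j where j: "j \<in> {1..d}" "k j \<noteq> i0 j"
      using k i0 unfolding grid_index_def by (metis PiE_ext)
    then have "x j \<notin> grid_cell n (k j)"
      using i[OF j(1)] k by (auto simp: i0_def grid_index_def)
    then have "(\<Prod>j\<in>{1..d}. indicator (grid_cell n (k j)) (x j) :: real) = 0"
      using j(1) by (intro prod_zero bexI[of _ j]) auto
    with False show ?thesis
      by simp
  qed
  then have "step_function TYPE('p) d n f x = (\<Sum>k\<in>grid_index d n. if k = i0 then f (grid_point d n k) else 0)"
    unfolding step_function_def by (intro sum.cong refl) auto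
  also have "\<dots> = f (trunc_point CARD('p) d n x)"
    using i0 pt by (simp add: sum.delta[OF finite_grid_index[OF n]])
  finally show "step_function TYPE('p) d n f x = f (trunc_point CARD('p) d n x)" .
qed

lemma step_function_outside:
  assumes "x \<in> extensional {1..d}" "x \<notin> unit_cube d"
  shows "step_function TYPE('p::prime_card) d n f x = 0"
proof -
  obtain j where j: "j \<in> {1..d}" "x j \<notin> {0..<1}"
    using assms unfolding unit_cube_def PiE_iff by blast
  have "(\<Prod>j\<in>{1..d}. indicator (grid_cell n (i j :: 'p mod_ring poly)) (x j) :: real) = 0" for i
    using j grid_cell_subset[of n "i j"] by (intro prod_zero bexI[of _ j]) (auto simp: indicator_def)
  then show ?thesis
    by (simp only: step_function_def scaleR_zero_left sum.neutral_const)
qed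

lemma integral_step_function:
  assumes n: "1 \<le> n"
  shows "step_function TYPE('p::prime_card) d n f \<in> borel_measurable (Pi\<^sub>M {1..d} (\<lambda>_. lborel))"
    and "integral\<^sup>L (Pi\<^sub>M {1..d} (\<lambda>_. lborel)) (step_function TYPE('p) d n f) =
      (\<Sum>i\<in>grid_index d n. f (grid_point d n (i :: nat \<Rightarrow> 'p mod_ring poly))) / of_nat ((CARD('p) ^ n) ^ d)"
proof -
  let ?M = "Pi\<^sub>M {1..d} (\<lambda>_. lborel :: real measure)"
  let ?I = "\<lambda>i :: nat \<Rightarrow> 'p mod_ring poly. \<lambda>x. \<Prod>j\<in>{1..d}. indicator (grid_cell n (i j)) (x j) :: real"
  interpret product_sigma_finite "\<lambda>_ :: nat. lborel :: real measure"
    by standard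
  have cell: "integrable lborel (indicator (grid_cell n g) :: real \<Rightarrow> real)"
    "integral\<^sup>L lborel (indicator (grid_cell n g) :: real \<Rightarrow> real) = 1 / real CARD('p) ^ n" for g :: "'p mod_ring poly"
    by (auto simp: grid_cell_def)
  have int: "integrable ?M (?I i)" for i
    by (rule product_integrable_prod) (simp_all add: cell(1))
  have val: "integral\<^sup>L ?M (?I i) = 1 / real ((CARD('p) ^ n) ^ d)" for i
  proof -
    have "integral\<^sup>L ?M (?I i) = (\<Prod>j\<in>{1..d}. integral\<^sup>L lborel (indicator (grid_cell n (i j)) :: real \<Rightarrow> real))"
      by (rule product_integral_prod) (simp_all add: cell(1))
    then show ?thesis
      by (simp only: cell(2)) (simp add: power_one_over)
  qed
  have int': "integrable ?M (\<lambda>x. ?I i x *\<^sub>R f (grid_point d n i))" for i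
    by (intro integrable_scaleR_left int)
  show "step_function TYPE('p) d n f \<in> borel_measurable ?M"
    unfolding step_function_def by (intro borel_measurable_integrable Bochner_Integration.integrable_sum int')
  have "integral\<^sup>L ?M (step_function TYPE('p) d n f) = (\<Sum>i\<in>grid_index d n. integral\<^sup>L ?M (?I i) *\<^sub>R f (grid_point d n i))"
    unfolding step_function_def
    by (subst Bochner_Integration.integral_sum[OF int']) (intro sum.cong refl integral_scaleR_left int)
  then show "integral\<^sup>L ?M (step_function TYPE('p) d n f) =
      (\<Sum>i\<in>grid_index d n. f (grid_point d n (i :: nat \<Rightarrow> 'p mod_ring poly))) / of_nat ((CARD('p) ^ n) ^ d)"
    unfolding val by (simp add: sum_divide_distrib scaleR_conv_of_real del: of_nat_power)
qed

lemma integrable_unit_cube: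
  fixes d :: nat
  shows "integrable (Pi\<^sub>M {1..d} (\<lambda>_. lborel)) (\<lambda>x. \<Prod>j\<in>{1..d}. indicator {0..<1} (x j :: real) :: real)"
proof -
  interpret product_sigma_finite "\<lambda>_ :: nat. lborel :: real measure"
    by standard
  show ?thesis
    by (rule product_integrable_prod[where f = "\<lambda>_. indicator {0..<1}"]) auto
qed

context walsh_rkhs
begin

lemma kernel_diag: "Re (walsh_kernel CARD('p) d \<alpha> \<gamma> x x) = Re (walsh_kernel CARD('p) d \<alpha> \<gamma> y y)"
  by (simp add: walsh_kernel_product[OF card_ge_2 \<alpha>] walsh_kernel1_diag[OF card_ge_2 \<alpha>])

text \<open>All diagonal values of the kernel equal S, and the mixed values along the truncations
  tend to S as well, so the sections at the truncated points approach the section at x in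
  norm.\<close>

lemma trunc_point_tendsto:
  assumes f: "f \<in> H" and x: "x \<in> unit_cube d"
  shows "(\<lambda>n. f (trunc_point CARD('p) d (Suc n) x)) \<longlonglongrightarrow> f x"
proof -
  let ?K = "walsh_kernel CARD('p) d \<alpha> \<gamma>"
  let ?y = "\<lambda>n. trunc_point CARD('p) d (Suc n) x"
  define S :: complex where "S = 1 + (\<Sum>u\<in>Pow {1..d} - {{}}. of_real (\<gamma> u) * (\<Prod>j\<in>u. of_real (mu CARD('p) \<alpha>)))"
  have diag: "?K z z = S" for z
    by (simp add: S_def walsh_kernel_product[OF card_ge_2 \<alpha>] walsh_kernel1_diag[OF card_ge_2 \<alpha>])
  have "(\<lambda>n. walsh_kernel1 CARD('p) \<alpha> (x j) (?y n j)) \<longlonglongrightarrow> of_real (mu CARD('p) \<alpha>)" if "j \<in> {1..d}" for j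
    using filterlim_compose[OF walsh_kernel1_trunc_tendsto[OF card_ge_2[where 'p = 'p] \<alpha>, of "x j"] filterlim_Suc] that
    by (simp add: trunc_point_def)
  then have lim: "(\<lambda>n. ?K x (?y n)) \<longlonglongrightarrow> S"
    unfolding walsh_kernel_product[OF card_ge_2 \<alpha>] S_def by (intro tendsto_intros) auto
  then have "(\<lambda>n. cnj (?K x (?y n))) \<longlonglongrightarrow> cnj S"
    by (rule tendsto_cnj)
  then have lim': "(\<lambda>n. ?K (?y n) x) \<longlonglongrightarrow> S"
    by (simp add: cnj_walsh_kernel[OF card_ge_2 \<alpha>] S_def)
  have "(\<lambda>n. ip_norm ip f * sqrt (Re (?K x x + ?K (?y n) (?y n) - ?K x (?y n) - ?K (?y n) x)))
      \<longlonglongrightarrow> ip_norm ip f * sqrt (Re (S + S - S - S))"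
    unfolding diag by (intro tendsto_intros lim lim')
  then have "(\<lambda>n. ip_norm ip f * sqrt (Re (?K x x + ?K (?y n) (?y n) - ?K x (?y n) - ?K (?y n) x))) \<longlonglongrightarrow> 0"
    by simp
  moreover have "\<forall>\<^sub>F n in sequentially. norm (f x - f (?y n)) \<le>
      ip_norm ip f * sqrt (Re (?K x x + ?K (?y n) (?y n) - ?K x (?y n) - ?K (?y n) x))"
    using step_function_eq(2)[OF _ x, where 'p = 'p] by (intro always_eventually allI pointwise_difference_bound f x) auto
  ultimately have "(\<lambda>n. f x - f (?y n)) \<longlonglongrightarrow> 0"
    by (rule Lim_null_comparison[rotated])
  then have "(\<lambda>n. f x - (f x - f (?y n))) \<longlonglongrightarrow> f x - 0"
    by (intro tendsto_intros)
  then show ?thesis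
    by simp
qed

text \<open>Both sides are limits of grid averages.\<close>

lemma integral_eq_ip:
  assumes f: "f \<in> H"
  shows "set_lebesgue_integral (Pi\<^sub>M {1..d} (\<lambda>_. lborel)) (unit_cube d) f = ip f one"
proof -
  let ?M = "Pi\<^sub>M {1..d} (\<lambda>_. lborel :: real measure)"
  let ?g = "\<lambda>x. indicator (unit_cube d) x *\<^sub>R f x"
  let ?s = "\<lambda>n. step_function TYPE('p) d (Suc n) f"
  \<comment> \<open>The diagonal of the kernel is constant, so its value at any one point bounds f
    on the whole cube.\<close>
  define B where "B = ip_norm ip f * sqrt (Re (walsh_kernel CARD('p) d \<alpha> \<gamma> (\<lambda>_. 0) (\<lambda>_. 0)))"
  have bound: "cmod (f x) \<le> B" if "x \<in> unit_cube d" for x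
    using pointwise_bound[OF f that] kernel_diag[of x "\<lambda>_. 0"] by (simp add: B_def)
  have ext: "x \<in> extensional {1..d}" if "x \<in> space ?M" for x
    using that by (auto simp: space_PiM PiE_def)
  have lim: "(\<lambda>n. ?s n x) \<longlonglongrightarrow> ?g x" if "x \<in> space ?M" for x
    using trunc_point_tendsto[OF f, of x] step_function_outside[OF ext[OF that], where 'p = 'p]
    by (cases "x \<in> unit_cube d") (simp_all add: step_function_eq(1)[where 'p = 'p])
  have cube: "(\<Prod>j\<in>{1..d}. indicator {0..<1} (x j) :: real) = indicator (unit_cube d) x" if "x \<in> extensional {1..d}" for x
    using that by (auto simp: indicator_def unit_cube_def PiE_def Pi_def intro!: prod_zero)
  have "(\<lambda>n. integral\<^sup>L ?M (?s n)) \<longlonglongrightarrow> integral\<^sup>L ?M ?g"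
  proof (rule integral_dominated_convergence[where w = "\<lambda>x. B * (\<Prod>j\<in>{1..d}. indicator {0..<1} (x j))"])
    show meas: "?s n \<in> borel_measurable ?M" for n
      by (rule integral_step_function(1)) simp
    \<comment> \<open>The axioms of the space say nothing about measurability; f inherits it from
      the step functions as their pointwise limit.\<close>
    show "?g \<in> borel_measurable ?M"
      by (rule borel_measurable_LIMSEQ_metric[OF meas lim])
    show "integrable ?M (\<lambda>x. B * (\<Prod>j\<in>{1..d}. indicator {0..<1} (x j)))"
      by (intro integrable_mult_right integrable_unit_cube)
    show "AE x in ?M. (\<lambda>n. ?s n x) \<longlonglongrightarrow> ?g x"
      using lim by (rule AE_I2)
    show "AE x in ?M. norm (?s n x) \<le> B * (\<Prod>j\<in>{1..d}. indicator {0..<1} (x j))" for n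
    proof (rule AE_I2)
      fix x assume x: "x \<in> space ?M"
      show "norm (?s n x) \<le> B * (\<Prod>j\<in>{1..d}. indicator {0..<1} (x j))"
      proof (cases "x \<in> unit_cube d")
        case True
        then show ?thesis
          unfolding cube[OF ext[OF x]]
          using step_function_eq[OF _ True, where 'p = 'p, of "Suc n"] bound by simp
      next
        case False
        then show ?thesis
          unfolding cube[OF ext[OF x]]
          using step_function_outside[OF ext[OF x] False, where 'p = 'p] by simp
      qed
    qed
  qed
  moreover have "integral\<^sup>L ?M (?s n) = ip f (grid_average p n)" for n
    unfolding ip_grid_average[OF f] by (rule integral_step_function(2)) simp
  ultimately have "integral\<^sup>L ?M ?g = ip f one"
    using ip_grid_average_tendsto[OF f] LIMSEQ_unique by simp
  then show ?thesis
    by (simp add: set_lebesgue_integral_def)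
qed

end

section \<open>The worst-case error of a polynomial lattice rule\<close>

text \<open>Membership in the dual lattice is a 0/1 factor, so that the index set stays a full
  product and can be split by coordinates. The exponent is a parameter because both \<alpha> and
  \<alpha>\<lambda> occur.\<close>

definition dual_sum :: "nat \<Rightarrow> real \<Rightarrow> (nat \<Rightarrow> 'p::prime_card mod_ring poly) \<Rightarrow> nat set \<Rightarrow> real" where
  "dual_sum m \<beta> v u = (\<Sum>\<^sub>\<infinity>h\<in>u \<rightarrow>\<^sub>E {1..}. (\<Prod>j\<in>u. walsh_weight CARD('p) \<beta> (h j)) *
     of_bool (Polynomial.monom 1 m dvd (\<Sum>j\<in>u. digit_poly (h j) * v j)))"

lemma summable_prod_walsh_weight:
  assumes "finite u" "2 \<le> b" "\<beta> > 1"
  shows "(\<lambda>h. \<Prod>j\<in>u. walsh_weight b \<beta> (h j)) summable_on (u \<rightarrow>\<^sub>E {1..})"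
  using assms by (intro summable_prod_PiE walsh_weight_summable) auto

lemma dual_sum_summable:
  fixes v :: "nat \<Rightarrow> 'p::prime_card mod_ring poly"
  assumes "finite u" "\<beta> > 1"
  shows "(\<lambda>h. (\<Prod>j\<in>u. walsh_weight CARD('p) \<beta> (h j)) *
     of_bool (Polynomial.monom 1 m dvd (\<Sum>j\<in>u. digit_poly (h j) * v j))) summable_on (u \<rightarrow>\<^sub>E {1..})"
  using summable_prod_walsh_weight[OF assms(1) card_ge_2 assms(2)]
  by (rule summable_on_comparison_test) (auto simp: prod_nonneg)

lemma has_sum_prod_walsh_kernel1:
  assumes "finite u" "2 \<le> b" "\<alpha> > 1"
  shows "((\<lambda>h. \<Prod>j\<in>u. walsh_term b \<alpha> (x j) (y j) (h j)) has_sum (\<Prod>j\<in>u. walsh_kernel1 b \<alpha> (x j) (y j))) (u \<rightarrow>\<^sub>E {1..})"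
proof -
  have "(\<lambda>h. \<Prod>j\<in>u. walsh_term b \<alpha> (x j) (y j) (h j)) summable_on (u \<rightarrow>\<^sub>E {1..})"
    by (rule abs_summable_summable) (simp only: prod_norm[symmetric] norm_walsh_term summable_prod_walsh_weight[OF assms])
  moreover have "infsum (\<lambda>h. \<Prod>j\<in>u. walsh_term b \<alpha> (x j) (y j) (h j)) (u \<rightarrow>\<^sub>E {1..}) =
      (\<Prod>j\<in>u. infsum (walsh_term b \<alpha> (x j) (y j)) {1..})"
    by (rule infsum_prod_PiE_abs[OF assms(1)]) (simp add: norm_walsh_term walsh_weight_summable[OF assms(2,3)])
  ultimately show ?thesis
    by (simp add: has_sum_iff walsh_kernel1_def)
qed

text \<open>The characters of the single coordinates multiply to one character, evaluated at a
  coefficient of the combined polynomial times n; orthogonality then tests the congruence.\<close>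

lemma lattice_character_sum:
  fixes v :: "nat \<Rightarrow> 'p::prime_card mod_ring poly"
  assumes u: "finite u" and m: "1 \<le> m"
  shows "(\<Sum>n | degree n < m. \<Prod>j\<in>u. wal CARD('p) (h j) (nu m (n * v j))) =
    of_nat (CARD('p) ^ m) * of_bool (Polynomial.monom 1 m dvd (\<Sum>j\<in>u. digit_poly (h j) * v j))"
proof -
  have "(\<Prod>j\<in>u. wal CARD('p) (h j) (nu m (n * v j))) =
      chi (poly.coeff ((\<Sum>j\<in>u. digit_poly (h j) * v j) * n) (m - 1))" for n
    by (simp add: wal_nu[OF m] chi_sum[OF u, symmetric] coeff_sum[symmetric] sum_distrib_left sum_distrib_right mult_ac)
  then show ?thesis
    by (simp only: character_orthogonality[OF m]) simp
qed

text \<open>For fixed h the sums over n and n' separate into a character sum and its conjugate. Each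
  equals b^m times the same indicator, which explains the square.\<close>

lemma lattice_kernel_sum:
  fixes v :: "nat \<Rightarrow> 'p::prime_card mod_ring poly"
  assumes u: "finite u" and m: "1 \<le> m" and \<alpha>: "\<alpha> > 1"
  shows "(\<Sum>n | degree n < m. \<Sum>n' | degree n' < m. \<Prod>j\<in>u. walsh_kernel1 CARD('p) \<alpha> (nu m (n * v j)) (nu m (n' * v j)))
    = of_real (dual_sum m \<alpha> v u) * (of_nat (CARD('p) ^ m))\<^sup>2" (is "?S = _")
proof -
  let ?P = "{n :: 'p mod_ring poly. degree n < m}"
  let ?N = "of_nat (CARD('p) ^ m) :: complex"
  let ?d = "\<lambda>h. of_bool (Polynomial.monom 1 m dvd (\<Sum>j\<in>u. digit_poly (h j) * v j))"
  let ?t = "\<lambda>h. (\<Prod>j\<in>u. walsh_weight CARD('p) \<alpha> (h j)) * ?d h"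
  let ?w = "\<lambda>h n. \<Prod>j\<in>u. wal CARD('p) (h j) (nu m (n * v j))"
  have "((\<lambda>h. \<Sum>n\<in>?P. \<Sum>n'\<in>?P. \<Prod>j\<in>u. walsh_term CARD('p) \<alpha> (nu m (n * v j)) (nu m (n' * v j)) (h j)) has_sum ?S) (u \<rightarrow>\<^sub>E {1..})"
    by (intro has_sum_sum finite_degree_less m has_sum_prod_walsh_kernel1 u card_ge_2 \<alpha>)
  also have "(\<lambda>h. \<Sum>n\<in>?P. \<Sum>n'\<in>?P. \<Prod>j\<in>u. walsh_term CARD('p) \<alpha> (nu m (n * v j)) (nu m (n' * v j)) (h j)) =
      (\<lambda>h. of_real (?t h) * ?N\<^sup>2)"
  proof
    fix h
    have "(\<Sum>n\<in>?P. \<Sum>n'\<in>?P. \<Prod>j\<in>u. walsh_term CARD('p) \<alpha> (nu m (n * v j)) (nu m (n' * v j)) (h j)) =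
        (\<Sum>n\<in>?P. \<Sum>n'\<in>?P. of_real (\<Prod>j\<in>u. walsh_weight CARD('p) \<alpha> (h j)) * (?w h n * cnj (?w h n')))"
      by (simp add: walsh_term_def prod.distrib mult.assoc)
    also have "\<dots> = of_real (\<Prod>j\<in>u. walsh_weight CARD('p) \<alpha> (h j)) * ((\<Sum>n\<in>?P. ?w h n) * cnj (\<Sum>n\<in>?P. ?w h n))"
      by (simp only: sum_distrib_left[symmetric] sum_distrib_right[symmetric] cnj_sum)
    also have "\<dots> = of_real (?t h) * ?N\<^sup>2"
      unfolding lattice_character_sum[OF u m] by (simp add: power2_eq_square)
    finally show "(\<Sum>n\<in>?P. \<Sum>n'\<in>?P. \<Prod>j\<in>u. walsh_term CARD('p) \<alpha> (nu m (n * v j)) (nu m (n' * v j)) (h j)) =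
        of_real (?t h) * ?N\<^sup>2" .
  qed
  finally have 1: "((\<lambda>h. of_real (?t h) * ?N\<^sup>2) has_sum ?S) (u \<rightarrow>\<^sub>E {1..})" .
  have "(?t has_sum dual_sum m \<alpha> v u) (u \<rightarrow>\<^sub>E {1..})"
    unfolding dual_sum_def by (rule has_sum_infsum[OF dual_sum_summable[OF u \<alpha>]])
  then have "((\<lambda>h. of_real (?t h) * ?N\<^sup>2) has_sum (of_real (dual_sum m \<alpha> v u) * ?N\<^sup>2)) (u \<rightarrow>\<^sub>E {1..})"
    by (intro has_sum_cmult_left has_sum_of_real)
  with 1 show ?thesis
    by (rule has_sum_unique)
qed

lemma lattice_point_mem: "lattice_point m d v n \<in> unit_cube d"
  by (simp add: lattice_point_def unit_cube_def restrict_PiE_iff nu_in_unit_interval del: atLeastLessThan_iff)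

context walsh_rkhs
begin

lemma lattice_kernel_mean:
  fixes v :: "nat \<Rightarrow> 'p mod_ring poly"
  assumes m: "1 \<le> m"
  shows "(\<Sum>n | degree n < m. \<Sum>n' | degree n' < m. walsh_kernel CARD('p) d \<alpha> \<gamma> (lattice_point m d v n) (lattice_point m d v n'))
      / (of_nat (CARD('p) ^ m))\<^sup>2 = of_real (1 + (\<Sum>u\<in>Pow {1..d} - {{}}. \<gamma> u * dual_sum m \<alpha> v u))"
proof -
  let ?P = "{n :: 'p mod_ring poly. degree n < m}"
  let ?N = "of_nat (CARD('p) ^ m) :: complex"
  have "(\<Sum>n\<in>?P. \<Sum>n'\<in>?P. \<Prod>j\<in>u. walsh_kernel1 CARD('p) \<alpha> (lattice_point m d v n j) (lattice_point m d v n' j)) =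
      of_real (dual_sum m \<alpha> v u) * ?N\<^sup>2" if u: "u \<in> Pow {1..d} - {{}}" for u
  proof -
    have "finite u"
      using u by (auto intro: finite_subset)
    have "(\<Sum>n\<in>?P. \<Sum>n'\<in>?P. \<Prod>j\<in>u. walsh_kernel1 CARD('p) \<alpha> (lattice_point m d v n j) (lattice_point m d v n' j)) =
        (\<Sum>n\<in>?P. \<Sum>n'\<in>?P. \<Prod>j\<in>u. walsh_kernel1 CARD('p) \<alpha> (nu m (n * v j)) (nu m (n' * v j)))"
      using u by (intro sum.cong prod.cong refl) (auto simp: lattice_point_def)
    then show ?thesis
      using lattice_kernel_sum[OF \<open>finite u\<close> m \<alpha>] by simp
  qed
  note part = this
  have "(\<Sum>n\<in>?P. \<Sum>n'\<in>?P. walsh_kernel CARD('p) d \<alpha> \<gamma> (lattice_point m d v n) (lattice_point m d v n')) =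
      ?N\<^sup>2 + (\<Sum>u\<in>Pow {1..d} - {{}}. of_real (\<gamma> u) * (\<Sum>n\<in>?P. \<Sum>n'\<in>?P.
        \<Prod>j\<in>u. walsh_kernel1 CARD('p) \<alpha> (lattice_point m d v n j) (lattice_point m d v n' j)))"
    unfolding walsh_kernel_product[OF card_ge_2 \<alpha>] sum.distrib sum_distrib_left
    by (simp add: sum.swap[of _ _ "Pow {Suc 0..d} - {{}}"] card_degree_less[OF m] power2_eq_square)
  also have "\<dots> = ?N\<^sup>2 + (\<Sum>u\<in>Pow {1..d} - {{}}. of_real (\<gamma> u) * (of_real (dual_sum m \<alpha> v u) * ?N\<^sup>2))"
    using part by (intro arg_cong2[where f = "(+)"] sum.cong refl) auto
  also have "\<dots> = of_real (1 + (\<Sum>u\<in>Pow {1..d} - {{}}. \<gamma> u * dual_sum m \<alpha> v u)) * ?N\<^sup>2"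
    by (simp add: distrib_right sum_distrib_right mult.assoc)
  finally show ?thesis
    by simp
qed

lemma worst_case_error_squared:
  fixes v :: "nat \<Rightarrow> 'p mod_ring poly"
  assumes m: "1 \<le> m"
  shows "(worst_case_error m d H ip v)\<^sup>2 = (\<Sum>u\<in>Pow {1..d} - {{}}. \<gamma> u * dual_sum m \<alpha> v u)"
proof -
  let ?P = "{n :: 'p mod_ring poly. degree n < m}"
  define q where "q = kernel_average (lattice_point m d v) ?P"
  define z where "z = (\<lambda>x. one x - q x)"
  have fin: "finite ?P" and img: "lattice_point m d v ` ?P \<subseteq> unit_cube d"
    using finite_degree_less[OF m] lattice_point_mem by auto
  have q: "q \<in> H"
    unfolding q_def by (rule kernel_average_mem[OF fin img])
  have z: "z \<in> H"
    unfolding z_def by (rule diff_closed[OF one_mem q])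
  have ip_q: "ip f q = lattice_rule m d v f" if "f \<in> H" for f
    unfolding q_def ip_kernel_average[OF fin img that] by (simp add: lattice_rule_def card_degree_less[OF m])
  have "worst_case_error m d H ip v = ip_norm ip z"
    unfolding worst_case_error_def
    by (rule norm_representer[OF z]) (simp only: integral_eq_ip ip_q z_def ip_diff_right one_mem q)
  moreover have "ip z z = of_real (\<Sum>u\<in>Pow {1..d} - {{}}. \<gamma> u * dual_sum m \<alpha> v u)"
  proof -
    \<comment> \<open>The rule is exact for the constant 1, so both cross terms are 1 and the
      squared norm of z is that of q minus 1.\<close>
    have "ip one q = 1"
      unfolding ip_q[OF one_mem] by (simp add: lattice_rule_def one_def lattice_point_mem card_degree_less[OF m])
    then have "ip q one = 1"
      using ip_conj[OF one_mem q] by simp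
    have "ip q q = (\<Sum>n\<in>?P. \<Sum>n'\<in>?P. walsh_kernel CARD('p) d \<alpha> \<gamma> (lattice_point m d v n) (lattice_point m d v n'))
        / (of_nat (CARD('p) ^ m))\<^sup>2"
      unfolding q_def ip_kernel_averages[OF fin img fin img] by (simp add: card_degree_less[OF m] power2_eq_square)
    also have "\<dots> = of_real (1 + (\<Sum>u\<in>Pow {1..d} - {{}}. \<gamma> u * dual_sum m \<alpha> v u))"
      by (rule lattice_kernel_mean[OF m])
    finally have "ip q q = of_real (1 + (\<Sum>u\<in>Pow {1..d} - {{}}. \<gamma> u * dual_sum m \<alpha> v u))" .
    moreover have "ip z z = ip one one - ip one q - (ip q one - ip q q)"
      using z unfolding z_def by (simp add: ip_diff ip_diff_right one_mem q)
    ultimately show ?thesis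
      using \<open>ip one q = 1\<close> \<open>ip q one = 1\<close> by (simp add: ip_one_one)
  qed
  then have "Re (ip z z) = (\<Sum>u\<in>Pow {1..d} - {{}}. \<gamma> u * dual_sum m \<alpha> v u)"
    by simp
  ultimately show ?thesis
    using ip_nonneg[OF z] by (simp add: ip_norm_def)
qed

end

section \<open>Counting solutions in the search set\<close>

text \<open>A common divisor of z and x divides the constant term of z, which is a unit.\<close>

lemma coprime_monomI:
  assumes "poly.coeff z 0 \<noteq> (0 :: 'p::prime_card mod_ring)"
  shows "coprime z (Polynomial.monom 1 m)"
proof -
  have "coprime z [:0, 1:]"
  proof (rule coprimeI)
    fix c assume c: "c dvd z" "c dvd [:0, 1:]"
    obtain a q where z: "z = pCons a q"
      by (cases z) auto
    have "pCons a q = [:a:] + [:0, 1:] * q"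
      by simp
    then have "c dvd [:a:]"
      using c z by (metis dvd_add_left_iff dvd_mult2)
    moreover have "is_unit [:a:]"
      using assms z by (simp add: is_unit_const_poly_iff)
    ultimately show "is_unit c"
      by (rule dvd_unit_imp_unit)
  qed
  then show ?thesis
    by (simp add: monom_altdef coprime_power_right_iff)
qed

lemma le_imp_monom_dvd: "m \<le> n \<Longrightarrow> Polynomial.monom 1 m dvd (Polynomial.monom 1 n :: 'a :: comm_semiring_1 poly)"
  by (simp add: monom_1_dvd_iff')

lemma coprime_search_set:
  assumes "z \<in> search_set m w"
  shows "coprime z (Polynomial.monom 1 m)"
  using assms by (auto simp: search_set_def coprime_iff_gcd_eq_1 split: if_splits)

lemma card_degree_less_dvd:
  assumes "v \<le> M" "1 \<le> M"
  shows "finite {y :: 'p::prime_card mod_ring poly. degree y < M \<and> Polynomial.monom 1 (M - v) dvd y}"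
    and "card {y :: 'p::prime_card mod_ring poly. degree y < M \<and> Polynomial.monom 1 (M - v) dvd y} \<le> CARD('p) ^ v"
proof -
  let ?Y = "{y :: 'p mod_ring poly. degree y < M \<and> Polynomial.monom 1 (M - v) dvd y}"
  \<comment> \<open>Quotients by x^(M-v) have degree below v. For v = 0 only the quotient 0 remains,
    which the condition \<open>degree q < 0\<close> would miss because the zero polynomial has
    degree 0.\<close>
  let ?Q = "if v = 0 then {0} else {q :: 'p mod_ring poly. degree q < v}"
  have Q: "finite ?Q" "card ?Q = CARD('p) ^ v"
    by (auto simp: finite_degree_less card_degree_less)
  have sub: "?Y \<subseteq> (\<lambda>q. Polynomial.monom 1 (M - v) * q) ` ?Q"
  proof
    fix y assume y: "y \<in> ?Y"
    then obtain q where q: "y = Polynomial.monom 1 (M - v) * q"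
      by (auto elim: dvdE)
    have "q \<in> ?Q"
    proof (cases "q = 0")
      case False
      then have "degree y = (M - v) + degree q"
        unfolding q by (subst degree_mult_eq) (auto simp: degree_monom_eq)
      with y assms show ?thesis by auto
    qed auto
    with q show "y \<in> (\<lambda>q. Polynomial.monom 1 (M - v) * q) ` ?Q"
      by blast
  qed
  then show "finite ?Y"
    using Q(1) by (meson finite_imageI finite_subset)
  have "card ?Y \<le> card ((\<lambda>q. Polynomial.monom 1 (M - v) * q) ` ?Q)"
    using Q(1) sub by (intro card_mono finite_imageI)
  also have "\<dots> \<le> card ?Q"
    by (rule card_image_le[OF Q(1)])
  finally show "card ?Y \<le> CARD('p) ^ v"
    by (simp only: Q(2))
qed

lemma finite_search_set: "finite (search_set m w)"
proof (cases "w < m")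
  case True
  then have "finite {z :: 'a mod_ring poly. degree z < m - w}"
    by (intro finite_degree_less) simp
  then show ?thesis
    by (rule rev_finite_subset) (use True in \<open>auto simp: search_set_def\<close>)
qed (simp add: search_set_def)

lemma one_mem_search_set: "1 \<in> search_set m w"
  by (simp add: search_set_def)

lemma card_search_set_ge:
  assumes "w < m"
  shows "(CARD('p) - 1) * CARD('p) ^ (m - w - 1) \<le> card (search_set m w :: 'p::prime_card mod_ring poly set)"
proof -
  let ?P = "{z :: 'p mod_ring poly. degree z < m - w}"
  \<comment> \<open>The exponent is 1, written in the form of \<open>card_degree_less_dvd\<close>
    for v = m - w - 1: the multiples of x are removed, and they make up at most the share
    1/b.\<close>
  let ?Y = "{z :: 'p mod_ring poly. degree z < m - w \<and> Polynomial.monom 1 (m - w - (m - w - 1)) dvd z}"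
  have M: "1 \<le> m - w" "m - w - (m - w - 1) = 1"
    using assms by auto
  have "?P - ?Y \<subseteq> search_set m w"
  proof
    fix z assume z: "z \<in> ?P - ?Y"
    then have "poly.coeff z 0 \<noteq> 0"
      using M by (auto simp: monom_1_dvd_iff')
    then have "coprime z (Polynomial.monom 1 m)" "z \<noteq> 0"
      using coprime_monomI by auto
    with z assms show "z \<in> search_set m w"
      by (simp add: search_set_def coprime_iff_gcd_eq_1)
  qed
  then have "card (?P - ?Y) \<le> card (search_set m w :: 'p mod_ring poly set)"
    by (intro card_mono finite_search_set)
  moreover have "card (?P - ?Y) = card ?P - card ?Y"
    using M by (intro card_Diff_subset card_degree_less_dvd) auto
  moreover have "card ?P = CARD('p) * CARD('p) ^ (m - w - 1)"
    using M power_minus_mult[of "m - w" "CARD('p)"] by (simp add: card_degree_less[OF M(1)] mult.commute)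
  moreover have "card ?Y \<le> CARD('p) ^ (m - w - 1)"
    using M by (intro card_degree_less_dvd) auto
  ultimately show ?thesis
    unfolding diff_mult_distrib nat_mult_1 by linarith
qed

text \<open>The source of the factor b/(b-1). If w >= m, the search set is {1} and the truncated
  difference m - w is 0, so the bound reads 1 <= b/(b-1).\<close>

lemma inverse_card_search_set_le:
  "1 / real (card (search_set m w :: 'p::prime_card mod_ring poly set)) \<le>
    real CARD('p) / (real CARD('p) - 1) / real CARD('p) ^ (m - w)"
proof (cases "w < m")
  case True
  let ?b = "real CARD('p)"
  have b: "?b \<ge> 2"
    using card_ge_2[where 'p = 'p] by (metis of_nat_le_iff of_nat_numeral)
  have "real ((CARD('p) - 1) * CARD('p) ^ (m - w - 1)) \<le> real (card (search_set m w :: 'p mod_ring poly set))"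
    using card_search_set_ge[OF True, where 'p = 'p] by (simp only: of_nat_le_iff)
  then have le: "(?b - 1) * ?b ^ (m - w - 1) \<le> real (card (search_set m w :: 'p mod_ring poly set))"
    by (simp add: of_nat_diff Suc_le_eq)
  moreover have pos: "0 < (?b - 1) * ?b ^ (m - w - 1)"
    using b by simp
  ultimately have "1 / real (card (search_set m w :: 'p mod_ring poly set)) \<le> 1 / ((?b - 1) * ?b ^ (m - w - 1))"
    by (intro frac_le) simp_all
  also have "\<dots> = ?b / (?b - 1) / ?b ^ (m - w)"
    using True b by (simp add: power_eq_if[of _ "m - w"])
  finally show ?thesis .
next
  case False
  have "real CARD('p) > 1"
    using card_ge_2[where 'p = 'p] by linarith
  with False show ?thesis
    by (simp add: search_set_def)
qed

text \<open>Two solutions differ by a solution of the homogeneous congruence. Write y = x^v h with v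
  < M. If h had constant term 0, then x^(v+1) would divide y and, as a solution exists, also c. So h
  is a unit modulo x^(M-v), and the difference is a multiple of x^(M-v). For v = M the bound counts
  all polynomials of degree below M.\<close>

lemma card_solutions_le:
  fixes c y :: "'p::prime_card mod_ring poly"
  assumes M: "1 \<le> M" and v: "v \<le> M" "v < M \<Longrightarrow> \<not> Polynomial.monom 1 (Suc v) dvd c"
    and dvd: "Polynomial.monom 1 v dvd y"
  shows "card {z. degree z < M \<and> Polynomial.monom 1 M dvd y * z + c} \<le> CARD('p) ^ v" (is "card ?S \<le> _")
proof (cases "?S = {}")
  case False
  then obtain z0 where z0: "degree z0 < M" "Polynomial.monom 1 M dvd y * z0 + c"
    by auto
  let ?Y = "{x :: 'p mod_ring poly. degree x < M \<and> Polynomial.monom 1 (M - v) dvd x}"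
  have "z - z0 \<in> ?Y" if z: "z \<in> ?S" for z
  proof -
    have "Polynomial.monom 1 M dvd (y * z + c) - (y * z0 + c)"
      using z z0 by (intro dvd_diff) auto
    then have diff: "Polynomial.monom 1 M dvd y * (z - z0)"
      by (simp add: algebra_simps)
    have "Polynomial.monom 1 (M - v) dvd z - z0"
    proof (cases "v < M")
      case True
      obtain h where h: "y = Polynomial.monom 1 v * h"
        using dvd by (elim dvdE)
      have "poly.coeff h 0 \<noteq> 0"
      proof
        assume "poly.coeff h 0 = 0"
        then have "Polynomial.monom 1 (Suc v) dvd y"
          by (auto simp: monom_1_dvd_iff' h coeff_monom_mult less_Suc_eq)
        moreover have "Polynomial.monom 1 (Suc v) dvd y * z0 + c"
          using True z0(2) by (meson Suc_leI dvd_trans le_imp_monom_dvd)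
        ultimately have "Polynomial.monom 1 (Suc v) dvd c"
          by (metis dvd_add_right_iff dvd_mult2)
        with v(2)[OF True] show False by simp
      qed
      then have cop: "coprime (Polynomial.monom 1 (M - v)) h"
        using coprime_monomI coprime_commute by blast
      have "Polynomial.monom 1 M = Polynomial.monom 1 v * (Polynomial.monom 1 (M - v) :: 'p mod_ring poly)"
        using True by (simp add: mult_monom)
      with diff have "Polynomial.monom 1 (M - v) dvd h * (z - z0)"
        by (simp add: h mult.assoc)
      with cop show ?thesis
        by (simp add: coprime_dvd_mult_right_iff)
    qed (use v in simp)
    moreover have "degree (z - z0) < M"
      using z z0 by (intro degree_diff_less) auto
    ultimately show ?thesis by simp
  qed
  then have "(\<lambda>z. z - z0) ` ?S \<subseteq> ?Y"
    by blast
  then have "card ((\<lambda>z. z - z0) ` ?S) \<le> card ?Y"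
    using v M by (intro card_mono card_degree_less_dvd)
  also have "\<dots> \<le> CARD('p) ^ v"
    using v M by (intro card_degree_less_dvd)
  finally show ?thesis
    by (subst (asm) card_image) (auto simp: inj_on_def)
next
  case True
  then show ?thesis
    by (simp only: card.empty)
qed

text \<open>
  With \<open>v\<close> the order of vanishing of \<open>c\<close>, capped at \<open>M\<close>: solvability for a unit \<open>z\<close> forces \<open>x^v\<close> to divide
  the polynomial of \<open>k\<close>, and then there are at most \<open>b^v\<close> solutions \<open>z\<close>.
\<close>

lemma search_set_solutions:
  fixes c :: "'p::prime_card mod_ring poly"
  assumes "w < m"
  shows "\<exists>v. \<forall>k. card {z \<in> search_set m w. Polynomial.monom 1 m dvd digit_poly k * (Polynomial.monom 1 w * z) + c}
      \<le> CARD('p) ^ v * of_bool (CARD('p) ^ v dvd k)"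
proof (cases "Polynomial.monom 1 w dvd c")
  case False
  \<comment> \<open>As w < m, a solution would force x^w to divide c. So there is none, and any v
    satisfies the bound.\<close>
  have "\<not> Polynomial.monom 1 m dvd digit_poly k * (Polynomial.monom 1 w * z) + c" for k and z :: "'p mod_ring poly"
  proof
    assume "Polynomial.monom 1 m dvd digit_poly k * (Polynomial.monom 1 w * z) + c"
    then have "Polynomial.monom 1 w dvd digit_poly k * (Polynomial.monom 1 w * z) + c"
      using assms by (meson dvd_trans le_imp_monom_dvd less_imp_le)
    then have "Polynomial.monom 1 w dvd c"
      by (metis dvd_add_right_iff dvd_mult dvd_triv_left)
    with False show False by simp
  qed
  then show ?thesis by simp
next
  case True
  then obtain e where e: "c = Polynomial.monom 1 w * e"
    by (elim dvdE)
  define M where "M = m - w"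
  have M: "1 \<le> M"
    using assms by (simp add: M_def)
  \<comment> \<open>Cancelling the common factor x^w lowers the modulus to x^M, and M is also the
    degree bound of the search set.\<close>
  have red: "Polynomial.monom 1 m dvd y * (Polynomial.monom 1 w * z) + c \<longleftrightarrow> Polynomial.monom 1 M dvd y * z + e"
    for y z :: "'p mod_ring poly"
  proof -
    have "y * (Polynomial.monom 1 w * z) + c = Polynomial.monom 1 w * (y * z + e)"
      by (simp add: e algebra_simps)
    moreover have "Polynomial.monom 1 m = Polynomial.monom 1 w * (Polynomial.monom 1 M :: 'p mod_ring poly)"
      using assms by (simp add: mult_monom M_def)
    ultimately show ?thesis
      by simp
  qed
  define v where "v = Max {v. v \<le> M \<and> Polynomial.monom 1 v dvd e}"
  have fin: "finite {v. v \<le> M \<and> Polynomial.monom 1 v dvd e}"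
    by simp
  have "{v. v \<le> M \<and> Polynomial.monom 1 v dvd e} \<noteq> {}"
    by (auto intro!: exI[of _ 0])
  then have v: "v \<le> M" "Polynomial.monom 1 v dvd e"
    using Max_in[OF fin] by (auto simp: v_def)
  have maxi: "\<not> Polynomial.monom 1 (Suc v) dvd e" if "v < M"
  proof
    assume "Polynomial.monom 1 (Suc v) dvd e"
    with that have "Suc v \<le> Max {v. v \<le> M \<and> Polynomial.monom 1 v dvd e}"
      by (intro Max_ge[OF fin]) simp
    then show False
      by (simp flip: v_def)
  qed
  show ?thesis
  proof (intro exI[of _ v] allI)
    fix k
    let ?S = "{z \<in> search_set m w. Polynomial.monom 1 m dvd digit_poly k * (Polynomial.monom 1 w * z) + c}"
    show "card ?S \<le> CARD('p) ^ v * of_bool (CARD('p) ^ v dvd k)"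
    proof (cases "CARD('p) ^ v dvd k")
      case True
      have sub: "?S \<subseteq> {z. degree z < M \<and> Polynomial.monom 1 M dvd digit_poly k * z + e}"
        using assms by (auto simp: red search_set_def M_def)
      have "finite {z. degree z < M \<and> Polynomial.monom 1 M dvd digit_poly k * z + e}"
        using finite_degree_less[OF M] by (rule rev_finite_subset) auto
      then have "card ?S \<le> card {z. degree z < M \<and> Polynomial.monom 1 M dvd digit_poly k * z + e}"
        using sub by (rule card_mono)
      also have "\<dots> \<le> CARD('p) ^ v"
        using True by (intro card_solutions_le M v maxi) (auto simp: dvd_digit_poly_iff)
      finally show ?thesis
        using True by simp
    next
      case False
      have "?S = {}"
      proof (rule ccontr)
        assume "?S \<noteq> {}"
        then obtain z where z: "z \<in> search_set m w" "Polynomial.monom 1 M dvd digit_poly k * z + e"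
          by (auto simp: red)
        have "Polynomial.monom 1 v dvd digit_poly k * z + e"
          using z(2) v(1) by (meson dvd_trans le_imp_monom_dvd)
        then have "Polynomial.monom 1 v dvd digit_poly k * z"
          using v(2) by (simp add: dvd_add_left_iff)
        moreover have "coprime (Polynomial.monom 1 v) z"
        proof -
          have "Polynomial.monom 1 v dvd (Polynomial.monom 1 m :: 'p mod_ring poly)"
            using v(1) by (intro le_imp_monom_dvd) (simp add: M_def)
          with coprime_search_set[OF z(1)] show ?thesis
            by (meson coprime_commute coprime_divisors dvd_refl)
        qed
        ultimately have "Polynomial.monom 1 v dvd (digit_poly k :: 'p mod_ring poly)"
          by (simp add: coprime_dvd_mult_left_iff)
        with False show False
          by (simp add: dvd_digit_poly_iff)
      qed
      then show ?thesis
        by (simp only: card.empty le0)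
    qed
  qed
qed

section \<open>Averaging over the search set\<close>

text \<open>On [0,1] one has t <= t^l; this is applied to the shares of x and y in x + y.\<close>

lemma powr_add_le:
  fixes x y l :: real
  assumes "0 \<le> x" "0 \<le> y" "0 < l" "l \<le> 1"
  shows "(x + y) powr l \<le> x powr l + y powr l"
proof (cases "x + y = 0")
  case False
  then have s: "0 < x + y"
    using assms by simp
  have frac: "t / (x + y) \<le> (t / (x + y)) powr l" if "0 \<le> t" "t \<le> x + y" for t
    using powr_mono'[of l 1 "t / (x + y)"] s assms that by (simp add: divide_le_eq)
  have "1 = x / (x + y) + y / (x + y)"
    using s by (simp add: add_divide_distrib[symmetric])
  also have "\<dots> \<le> (x / (x + y)) powr l + (y / (x + y)) powr l"
    using assms by (intro add_mono frac) auto
  also have "\<dots> = (x powr l + y powr l) / (x + y) powr l"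
    using assms by (simp add: powr_divide add_divide_distrib)
  finally show ?thesis
    using s by (simp add: le_divide_eq)
qed (use assms in simp)

lemma powr_sum_le:
  fixes f :: "'a \<Rightarrow> real"
  assumes "finite A" "\<And>x. x \<in> A \<Longrightarrow> 0 \<le> f x" "0 < l" "l \<le> 1"
  shows "(\<Sum>x\<in>A. f x) powr l \<le> (\<Sum>x\<in>A. f x powr l)"
  using assms(1,2)
proof (induction A rule: finite_induct)
  case (insert a A)
  then have "(f a + (\<Sum>x\<in>A. f x)) powr l \<le> f a powr l + (\<Sum>x\<in>A. f x) powr l"
    using assms(3,4) by (intro powr_add_le sum_nonneg) auto
  with insert show ?case by fastforce
qed simp

lemma powr_infsum_le:
  fixes f :: "'a \<Rightarrow> real"
  assumes f: "f summable_on A" "\<And>x. x \<in> A \<Longrightarrow> 0 \<le> f x"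
    and fl: "(\<lambda>x. f x powr l) summable_on A" and l: "0 < l" "l \<le> 1"
  shows "infsum f A powr l \<le> (\<Sum>\<^sub>\<infinity>x\<in>A. f x powr l)"
proof -
  let ?S = "\<Sum>\<^sub>\<infinity>x\<in>A. f x powr l"
  \<comment> \<open>With the power moved to the right-hand side, the infinite sum is bounded by
    bounding its finite partial sums.\<close>
  have "infsum f A \<le> ?S powr (1 / l)"
  proof (rule infsum_le_finite_sums[OF f(1)])
    fix F assume F: "finite F" "F \<subseteq> A"
    have "sum f F powr l \<le> (\<Sum>x\<in>F. f x powr l)"
      using F f(2) l by (intro powr_sum_le) auto
    also have "\<dots> \<le> ?S"
      using F fl by (intro finite_sum_le_infsum) auto
    finally have "(sum f F powr l) powr (1 / l) \<le> ?S powr (1 / l)"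
      using l by (intro powr_mono2) auto
    moreover have "0 \<le> sum f F"
      using F f(2) by (intro sum_nonneg) auto
    ultimately show "sum f F \<le> ?S powr (1 / l)"
      using l by (simp add: powr_powr)
  qed
  then have "infsum f A powr l \<le> (?S powr (1 / l)) powr l"
    using l f(2) by (intro powr_mono2 infsum_nonneg) auto
  also have "\<dots> = ?S"
    using l by (simp add: powr_powr infsum_nonneg)
  finally show ?thesis .
qed

lemma dual_sum_nonneg: "0 \<le> dual_sum m \<beta> v u"
  unfolding dual_sum_def by (intro infsum_nonneg mult_nonneg_nonneg prod_nonneg) auto

text \<open>The power fixes the 0/1 factor and turns the exponent \<alpha> of the weights into
  \<alpha>l, so the powers of the terms are again the terms of a dual sum.\<close>

lemma dual_sum_powr_le:
  fixes v :: "nat \<Rightarrow> 'p::prime_card mod_ring poly"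
  assumes u: "finite u" and "\<alpha> > 1" and "\<alpha> * l > 1" and l: "0 < l" "l \<le> 1"
  shows "dual_sum m \<alpha> v u powr l \<le> dual_sum m (\<alpha> * l) v u"
proof -
  let ?D = "\<lambda>h. of_bool (Polynomial.monom 1 m dvd (\<Sum>j\<in>u. digit_poly (h j) * v j)) :: real"
  have eq: "((\<Prod>j\<in>u. walsh_weight CARD('p) \<alpha> (h j)) * ?D h) powr l = (\<Prod>j\<in>u. walsh_weight CARD('p) (\<alpha> * l) (h j)) * ?D h"
    for h
    by (simp add: prod_powr_distrib walsh_weight_powr)
  show ?thesis
    unfolding dual_sum_def eq[symmetric]
    by (rule powr_infsum_le) (use assms dual_sum_summable[OF u, of "\<alpha> * l" m v] dual_sum_summable[OF u, of \<alpha> m v] in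
        \<open>auto simp: eq simp del: of_bool_eq intro!: mult_nonneg_nonneg prod_nonneg\<close>)
qed

section \<open>Dual sums summed over the search set\<close>

text \<open>Although v depends on c, the factor b^v cancels and the bound is uniform in c; this
  allows the old components to be summed out afterwards. If w >= m, only z = 1 remains, and the 0/1
  factor is estimated by 1.\<close>

lemma search_set_weight_sum_le:
  fixes c :: "'p::prime_card mod_ring poly"
  assumes \<beta>: "\<beta> > 1"
  shows "(\<Sum>z\<in>search_set m w. \<Sum>\<^sub>\<infinity>k\<in>{1..}. walsh_weight CARD('p) \<beta> k *
      of_bool (Polynomial.monom 1 m dvd digit_poly k * (Polynomial.monom 1 w * z) + c)) \<le> mu CARD('p) \<beta>"
    (is "?S \<le> _")
proof -
  let ?b = "CARD('p)"
  note b = card_ge_2[where 'p = 'p]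
  define P where "P k z \<longleftrightarrow> Polynomial.monom 1 m dvd digit_poly k * (Polynomial.monom 1 w * z) + c" for k z
  have sum: "((\<lambda>k. \<Sum>z\<in>search_set m w. walsh_weight ?b \<beta> k * of_bool (P k z)) has_sum ?S) {1..}"
    unfolding P_def[symmetric]
    by (intro has_sum_sum finite_search_set has_sum_infsum
        summable_on_comparison_test[OF walsh_weight_summable[OF b \<beta> order_refl]]) auto
  show ?thesis
  proof (cases "w < m")
    case True
    obtain v where v: "\<And>k. card {z \<in> search_set m w. P k z} \<le> ?b ^ v * of_bool (?b ^ v dvd k)"
      using search_set_solutions[OF True, of c] unfolding P_def by blast
    have "((\<lambda>k. walsh_weight ?b \<beta> k * of_bool (?b ^ v dvd k)) has_sum (real ?b powr (- \<beta> * real v) * mu ?b \<beta>)) {1..}"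
      using has_sum_multiples[OF b \<beta>, of v]
      by (rule has_sum_cong_neutral[THEN iffD1, rotated -1]) auto
    then have "((\<lambda>k. real ?b ^ v * (walsh_weight ?b \<beta> k * of_bool (?b ^ v dvd k))) has_sum
        (real ?b ^ v * (real ?b powr (- \<beta> * real v) * mu ?b \<beta>))) {1..}"
      by (rule has_sum_cmult_right)
    with sum have "?S \<le> real ?b ^ v * (real ?b powr (- \<beta> * real v) * mu ?b \<beta>)"
    proof (rule has_sum_mono)
      fix k
      have "(\<Sum>z\<in>search_set m w. walsh_weight ?b \<beta> k * of_bool (P k z)) =
          walsh_weight ?b \<beta> k * real (card {z \<in> search_set m w. P k z})"
        by (simp add: sum_distrib_left[symmetric] of_bool_def sum.If_cases finite_search_set Int_def)
      also have "\<dots> \<le> walsh_weight ?b \<beta> k * real (?b ^ v * of_bool (?b ^ v dvd k))"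
        using v[of k] by (intro mult_left_mono) (simp_all only: of_nat_le_iff walsh_weight_nonneg)
      also have "\<dots> = real ?b ^ v * (walsh_weight ?b \<beta> k * of_bool (?b ^ v dvd k))"
        by simp
      finally show "(\<Sum>z\<in>search_set m w. walsh_weight ?b \<beta> k * of_bool (P k z)) \<le>
          real ?b ^ v * (walsh_weight ?b \<beta> k * of_bool (?b ^ v dvd k))" .
    qed
    also have "\<dots> \<le> real ?b ^ v * (mu ?b \<beta> / real ?b ^ v)"
      using mu_multiples_le[OF b \<beta>] by (intro mult_left_mono) auto
    also have "\<dots> = mu ?b \<beta>"
      by simp
    finally show ?thesis .
  next
    case False
    then have Z: "search_set m w = {1 :: 'p mod_ring poly}"
      by (simp add: search_set_def)
    show ?thesis
      by (rule has_sum_mono[OF sum has_sum_mu[OF b \<beta>]]) (subst Z, subst sum.insert, auto)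
  qed
qed

lemma has_sum_prod_walsh_weight:
  assumes "finite u" "2 \<le> b" "\<beta> > 1"
  shows "((\<lambda>h. \<Prod>j\<in>u. walsh_weight b \<beta> (h j)) has_sum mu b \<beta> ^ card u) (u \<rightarrow>\<^sub>E {1..})"
proof -
  have "infsum (\<lambda>h. \<Prod>j\<in>u. walsh_weight b \<beta> (h j)) (u \<rightarrow>\<^sub>E {1..}) = (\<Prod>j\<in>u. infsum (walsh_weight b \<beta>) {1..})"
    by (rule infsum_prod_PiE[OF assms(1) walsh_weight_summable[OF assms(2,3) order_refl] summable_prod_walsh_weight[OF assms]])
  also have "infsum (walsh_weight b \<beta>) {1..} = mu b \<beta>"
    by (rule infsumI[OF has_sum_mu[OF assms(2,3)]])
  finally show ?thesis
    using summable_prod_walsh_weight[OF assms] by (simp add: has_sum_iff)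
qed

text \<open>A frequency vector on \<open>insert i u\<close> splits into its restriction to u and its
  entry k at i. For fixed old frequencies the inner series has the shape treated in
  \<open>search_set_weight_sum_le\<close>, with their contribution as c.\<close>

lemma dual_sum_insert:
  fixes v :: "nat \<Rightarrow> 'p::prime_card mod_ring poly"
  assumes u: "finite u" "i \<notin> u" and \<beta>: "\<beta> > 1"
  shows "((\<lambda>h. (\<Prod>j\<in>u. walsh_weight CARD('p) \<beta> (h j)) * (\<Sum>\<^sub>\<infinity>k\<in>{1..}. walsh_weight CARD('p) \<beta> k *
      of_bool (Polynomial.monom 1 m dvd digit_poly k * v i + (\<Sum>j\<in>u. digit_poly (h j) * v j))))
    has_sum dual_sum m \<beta> v (insert i u)) (u \<rightarrow>\<^sub>E {1..})"
proof -
  let ?b = "CARD('p)"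
  note b = card_ge_2[where 'p = 'p]
  let ?P = "\<lambda>h k. of_bool (Polynomial.monom 1 m dvd digit_poly k * v i + (\<Sum>j\<in>u. digit_poly (h j) * v j)) :: real"
  let ?W = "\<lambda>h. \<Prod>j\<in>u. walsh_weight ?b \<beta> (h j)"
  have "((\<lambda>h. (\<Prod>j\<in>insert i u. walsh_weight ?b \<beta> (h j)) *
      of_bool (Polynomial.monom 1 m dvd (\<Sum>j\<in>insert i u. digit_poly (h j) * v j))) has_sum dual_sum m \<beta> v (insert i u))
      (insert i u \<rightarrow>\<^sub>E {1..})"
    unfolding dual_sum_def using u \<beta> by (intro has_sum_infsum dual_sum_summable) auto
  also have "?this \<longleftrightarrow> ((\<lambda>(h, k). ?W h * (walsh_weight ?b \<beta> k * ?P h k)) has_sum dual_sum m \<beta> v (insert i u))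
      ((u \<rightarrow>\<^sub>E {1..}) \<times> {1..})"
  proof (rule has_sum_reindex_bij_witness[of _ "\<lambda>(h, k). h(i := k)" "\<lambda>h. (restrict h u, h i)"])
    fix h :: "nat \<Rightarrow> nat" assume h: "h \<in> insert i u \<rightarrow>\<^sub>E {1..}"
    show "(case (restrict h u, h i) of (h, k) \<Rightarrow> h(i := k)) = h"
      using h by (auto simp: fun_eq_iff PiE_def extensional_def)
    show "(restrict h u, h i) \<in> (u \<rightarrow>\<^sub>E {1..}) \<times> {1..}"
      using h by auto
    show "(case (restrict h u, h i) of (h, k) \<Rightarrow> ?W h * (walsh_weight ?b \<beta> k * ?P h k)) =
        (\<Prod>j\<in>insert i u. walsh_weight ?b \<beta> (h j)) *
        of_bool (Polynomial.monom 1 m dvd (\<Sum>j\<in>insert i u. digit_poly (h j) * v j))"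
      using u by simp
  next
    fix hk assume "hk \<in> (u \<rightarrow>\<^sub>E {1 :: nat..}) \<times> {1 :: nat..}"
    then obtain h k where hk: "hk = (h, k)" "h \<in> u \<rightarrow>\<^sub>E {1..}" "k \<in> {1..}"
      by auto
    show "(restrict (case hk of (h, k) \<Rightarrow> h(i := k)) u, (case hk of (h, k) \<Rightarrow> h(i := k)) i) = hk"
      using hk u by (auto simp: fun_eq_iff PiE_def extensional_def)
    show "(case hk of (h, k) \<Rightarrow> h(i := k)) \<in> insert i u \<rightarrow>\<^sub>E {1..}"
      using hk by (auto simp: PiE_def extensional_def Pi_def)
  qed simp
  finally show ?thesis
  proof (rule has_sum_SigmaD)
    fix h assume "h \<in> u \<rightarrow>\<^sub>E {1 :: nat..}"
    have "((\<lambda>k. walsh_weight ?b \<beta> k * ?P h k) has_sum (\<Sum>\<^sub>\<infinity>k\<in>{1..}. walsh_weight ?b \<beta> k * ?P h k)) {1..}"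
      by (intro has_sum_infsum summable_on_comparison_test[OF walsh_weight_summable[OF b \<beta> order_refl]]) auto
    then show "((\<lambda>k. case (h, k) of (h, k) \<Rightarrow> ?W h * (walsh_weight ?b \<beta> k * ?P h k)) has_sum
        (?W h * (\<Sum>\<^sub>\<infinity>k\<in>{1..}. walsh_weight ?b \<beta> k * ?P h k))) {1..}"
      by (simp add: has_sum_cmult_right)
  qed
qed

text \<open>The inner sums are at most \<open>mu\<close> for all old frequencies alike; the
  remaining sum of weights over u factors into one-dimensional series.\<close>

lemma sum_dual_sum_le:
  fixes v :: "nat \<Rightarrow> 'p::prime_card mod_ring poly"
  assumes u: "finite u" "i \<notin> u" and \<beta>: "\<beta> > 1"
  shows "(\<Sum>z\<in>search_set m w. dual_sum m \<beta> (v(i := Polynomial.monom 1 w * z)) (insert i u)) \<le> mu CARD('p) \<beta> ^ card (insert i u)"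
proof -
  let ?b = "CARD('p)"
  note b = card_ge_2[where 'p = 'p]
  let ?W = "\<lambda>h. \<Prod>j\<in>u. walsh_weight ?b \<beta> (h j)"
  let ?I = "\<lambda>h z. \<Sum>\<^sub>\<infinity>k\<in>{1..}. walsh_weight ?b \<beta> k *
      of_bool (Polynomial.monom 1 m dvd digit_poly k * (Polynomial.monom 1 w * z) + (\<Sum>j\<in>u. digit_poly (h j) * v j))"
  have "((\<lambda>h. ?W h * ?I h z) has_sum dual_sum m \<beta> (v(i := Polynomial.monom 1 w * z)) (insert i u)) (u \<rightarrow>\<^sub>E {1..})" for z
  proof -
    have "(\<Sum>j\<in>u. digit_poly (h j) * (v(i := Polynomial.monom 1 w * z)) j) = (\<Sum>j\<in>u. digit_poly (h j) * v j)" for h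
      using u by (intro sum.cong) auto
    then show ?thesis
      using dual_sum_insert[OF u \<beta>, of m "v(i := Polynomial.monom 1 w * z)"] by simp
  qed
  then have "((\<lambda>h. \<Sum>z\<in>search_set m w. ?W h * ?I h z) has_sum
      (\<Sum>z\<in>search_set m w. dual_sum m \<beta> (v(i := Polynomial.monom 1 w * z)) (insert i u))) (u \<rightarrow>\<^sub>E {1..})"
    by (intro has_sum_sum finite_search_set)
  moreover have "((\<lambda>h. ?W h * mu ?b \<beta>) has_sum (mu ?b \<beta> ^ card u * mu ?b \<beta>)) (u \<rightarrow>\<^sub>E {1..})"
    by (intro has_sum_cmult_left has_sum_prod_walsh_weight u b \<beta>)
  ultimately have "(\<Sum>z\<in>search_set m w. dual_sum m \<beta> (v(i := Polynomial.monom 1 w * z)) (insert i u)) \<le> mu ?b \<beta> ^ card u * mu ?b \<beta>"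
  proof (rule has_sum_mono)
    fix h
    have "(\<Sum>z\<in>search_set m w. ?W h * ?I h z) = ?W h * (\<Sum>z\<in>search_set m w. ?I h z)"
      by (simp only: sum_distrib_left)
    also have "\<dots> \<le> ?W h * mu ?b \<beta>"
      by (intro mult_left_mono search_set_weight_sum_le \<beta> prod_nonneg) simp
    finally show "(\<Sum>z\<in>search_set m w. ?W h * ?I h z) \<le> ?W h * mu ?b \<beta>" .
  qed
  with u show ?thesis
    by (simp add: mult.commute)
qed

lemma dual_sum_cong: "(\<And>j. j \<in> u \<Longrightarrow> v j = v' j) \<Longrightarrow> dual_sum m \<beta> v u = dual_sum m \<beta> v' u"
  unfolding dual_sum_def by (simp cong: sum.cong)

section \<open>The error recursion and the choice of one component\<close>

definition lattice_error ::
  "nat \<Rightarrow> real \<Rightarrow> (nat set \<Rightarrow> real) \<Rightarrow> nat \<Rightarrow> (nat \<Rightarrow> 'p::prime_card mod_ring poly) \<Rightarrow> real" where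
  "lattice_error m \<alpha> \<gamma> d v = (\<Sum>u\<in>Pow {1..d} - {{}}. \<gamma> u * dual_sum m \<alpha> v u)"

text \<open>The \<theta> of the overview: the contribution of the subsets containing d + 1, indexed
  by what is left after removing d + 1.\<close>

definition error_increment ::
  "nat \<Rightarrow> real \<Rightarrow> (nat set \<Rightarrow> real) \<Rightarrow> nat \<Rightarrow> (nat \<Rightarrow> 'p::prime_card mod_ring poly) \<Rightarrow> real" where
  "error_increment m \<alpha> \<gamma> d v = (\<Sum>u\<in>Pow {1..d}. \<gamma> (insert (Suc d) u) * dual_sum m \<alpha> v (insert (Suc d) u))"

lemma sum_nonempty_subsets_Suc:
  "(\<Sum>u\<in>Pow {1..Suc d} - {{}}. F u) = (\<Sum>u\<in>Pow {1..d} - {{}}. F u) + (\<Sum>u\<in>Pow {1..d}. F (insert (Suc d) u))"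
proof -
  have eq: "Pow {1..Suc d} - {{}} = (Pow {1..d} - {{}}) \<union> insert (Suc d) ` Pow {1..d}"
    by (auto simp: atLeastAtMostSuc_conv Pow_insert)
  have inj: "inj_on (insert (Suc d)) (Pow {1..d})"
    by (rule inj_onI) (metis PowD atLeastAtMost_iff insert_ident not_less_eq_eq order_refl subsetD)
  have "sum F (Pow {1..Suc d} - {{}}) = sum F (Pow {1..d} - {{}}) + sum F (insert (Suc d) ` Pow {1..d})"
    unfolding eq by (rule sum.union_disjoint) auto
  then show ?thesis
    by (simp only: sum.reindex[OF inj] o_def)
qed

lemma lattice_error_Suc: "lattice_error m \<alpha> \<gamma> (Suc d) v = lattice_error m \<alpha> \<gamma> d v + error_increment m \<alpha> \<gamma> d v"
  unfolding lattice_error_def error_increment_def by (rule sum_nonempty_subsets_Suc)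

lemma lattice_error_update: "lattice_error m \<alpha> \<gamma> d (v(Suc d := z)) = lattice_error m \<alpha> \<gamma> d v"
  unfolding lattice_error_def by (intro sum.cong refl arg_cong2[where f = "(*)"] dual_sum_cong) auto

lemma error_increment_nonneg:
  assumes "\<And>u. u \<subseteq> {1..Suc d} \<Longrightarrow> \<gamma> u > 0"
  shows "0 \<le> error_increment m \<alpha> \<gamma> d v"
  unfolding error_increment_def
proof (intro sum_nonneg mult_nonneg_nonneg dual_sum_nonneg)
  fix u assume "u \<in> Pow {1..d}"
  then have "insert (Suc d) u \<subseteq> {1..Suc d}"
    by auto
  then show "0 \<le> \<gamma> (insert (Suc d) u)"
    using assms less_imp_le by blast
qed

lemma error_increment_min_le:
  fixes v :: "nat \<Rightarrow> 'p::prime_card mod_ring poly"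
  assumes \<gamma>: "\<And>u. u \<subseteq> {1..Suc d} \<Longrightarrow> \<gamma> u > 0"
    and \<alpha>: "\<alpha> > 1" "\<alpha> * l > 1" and l: "0 < l" "l \<le> 1"
    and min: "\<And>z. z \<in> search_set m w \<Longrightarrow>
      error_increment m \<alpha> \<gamma> d v \<le> error_increment m \<alpha> \<gamma> d (v(Suc d := Polynomial.monom 1 w * z))"
  shows "error_increment m \<alpha> \<gamma> d v powr l \<le> real CARD('p) / (real CARD('p) - 1) *
    (\<Sum>u\<in>Pow {1..d}. \<gamma> (insert (Suc d) u) powr l * mu CARD('p) (\<alpha> * l) ^ card (insert (Suc d) u) / real CARD('p) ^ (m - w))"
proof -
  let ?b = "CARD('p)"
  let ?Z = "search_set m w :: 'p mod_ring poly set"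
  let ?v = "\<lambda>z. v(Suc d := Polynomial.monom 1 w * z)"
  let ?i = "insert (Suc d)"
  let ?R = "\<Sum>u\<in>Pow {1..d}. \<gamma> (?i u) powr l * mu ?b (\<alpha> * l) ^ card (?i u)"
  have \<gamma>0: "0 \<le> \<gamma> (?i u)" if "u \<in> Pow {1..d}" for u
  proof -
    have "?i u \<subseteq> {1..Suc d}"
      using that by auto
    then show ?thesis
      using \<gamma> less_imp_le by blast
  qed
  have fin: "finite u" "finite (?i u)" "Suc d \<notin> u" if "u \<in> Pow {1..d}" for u
    using that by (auto intro: finite_subset)
  have powr_le: "error_increment m \<alpha> \<gamma> d (?v z) powr l \<le> (\<Sum>u\<in>Pow {1..d}. \<gamma> (?i u) powr l * dual_sum m (\<alpha> * l) (?v z) (?i u))" for z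
  proof -
    have "error_increment m \<alpha> \<gamma> d (?v z) powr l \<le> (\<Sum>u\<in>Pow {1..d}. (\<gamma> (?i u) * dual_sum m \<alpha> (?v z) (?i u)) powr l)"
      unfolding error_increment_def using l by (intro powr_sum_le mult_nonneg_nonneg \<gamma>0 dual_sum_nonneg) auto
    also have "\<dots> \<le> (\<Sum>u\<in>Pow {1..d}. \<gamma> (?i u) powr l * dual_sum m (\<alpha> * l) (?v z) (?i u))"
    proof (rule sum_mono)
      fix u assume u: "u \<in> Pow {1..d}"
      have "dual_sum m \<alpha> (?v z) (?i u) powr l \<le> dual_sum m (\<alpha> * l) (?v z) (?i u)"
        by (rule dual_sum_powr_le[OF fin(2)[OF u] \<alpha> l])
      then show "(\<gamma> (?i u) * dual_sum m \<alpha> (?v z) (?i u)) powr l \<le> \<gamma> (?i u) powr l * dual_sum m (\<alpha> * l) (?v z) (?i u)"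
        using \<gamma>0[OF u] by (simp add: powr_mult dual_sum_nonneg mult_left_mono)
    qed
    finally show ?thesis .
  qed
  have "real (card ?Z) * error_increment m \<alpha> \<gamma> d v powr l = (\<Sum>z\<in>?Z. error_increment m \<alpha> \<gamma> d v powr l)"
    by simp
  \<comment> \<open>Powers are monotone, so minimality carries over to the l-th powers and holds
    against every summand.\<close>
  also have "\<dots> \<le> (\<Sum>z\<in>?Z. error_increment m \<alpha> \<gamma> d (?v z) powr l)"
    using l \<gamma> by (intro sum_mono powr_mono2 min error_increment_nonneg) auto
  also have "\<dots> \<le> (\<Sum>z\<in>?Z. \<Sum>u\<in>Pow {1..d}. \<gamma> (?i u) powr l * dual_sum m (\<alpha> * l) (?v z) (?i u))"
    by (intro sum_mono powr_le)
  also have "\<dots> = (\<Sum>u\<in>Pow {1..d}. \<gamma> (?i u) powr l * (\<Sum>z\<in>?Z. dual_sum m (\<alpha> * l) (?v z) (?i u)))"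
    unfolding sum_distrib_left by (rule sum.swap)
  also have "\<dots> \<le> ?R"
    by (intro sum_mono mult_left_mono sum_dual_sum_le fin \<alpha>) auto
  finally have main: "real (card ?Z) * error_increment m \<alpha> \<gamma> d v powr l \<le> ?R" .
  have "card ?Z \<noteq> 0"
    using finite_search_set[of m w] one_mem_search_set[of m w] by (metis card_0_eq empty_iff)
  then have "error_increment m \<alpha> \<gamma> d v powr l \<le> ?R * (1 / real (card ?Z))"
    using main by (simp add: field_simps)
  also have "\<dots> \<le> ?R * (real ?b / (real ?b - 1) / real ?b ^ (m - w))"
    using mu_nonneg[OF card_ge_2 \<alpha>(2), where 'p1 = 'p]
    by (intro mult_left_mono inverse_card_search_set_le sum_nonneg) auto
  also have "\<dots> = real ?b / (real ?b - 1) *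
      (\<Sum>u\<in>Pow {1..d}. \<gamma> (?i u) powr l * mu ?b (\<alpha> * l) ^ card (?i u) / real ?b ^ (m - w))"
    by (simp add: sum_divide_distrib[symmetric])
  finally show ?thesis .
qed

text \<open>The component g_1 = 1 is prescribed, not searched for. With a single coordinate, a unit
  z cancels from the congruence, so all candidates give the same increment and 1 is a
  minimizer.\<close>

lemma error_increment_first:
  fixes v :: "nat \<Rightarrow> 'p::prime_card mod_ring poly"
  assumes "z \<in> search_set m w"
  shows "error_increment m \<alpha> \<gamma> 0 (v(Suc 0 := Polynomial.monom 1 w * z)) =
    error_increment m \<alpha> \<gamma> 0 (v(Suc 0 := Polynomial.monom 1 w))"
proof -
  have "Polynomial.monom 1 m dvd y * (Polynomial.monom 1 w * z) \<longleftrightarrow> Polynomial.monom 1 m dvd y * Polynomial.monom 1 w"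
    for y :: "'p mod_ring poly"
    using coprime_search_set[OF assms] unfolding mult.assoc[symmetric]
    by (intro coprime_dvd_mult_left_iff) (simp add: coprime_commute)
  then show ?thesis
    by (simp add: error_increment_def dual_sum_def)
qed

theorem theorem3:
  fixes b m s :: nat
    and \<alpha> :: real
    and \<gamma> :: "nat set \<Rightarrow> real"
    and w :: "nat \<Rightarrow> nat"
    and g :: "nat \<Rightarrow> 'p::prime_card mod_ring poly"
    and H :: "nat \<Rightarrow> ((nat \<Rightarrow> real) \<Rightarrow> complex) set"
    and ip :: "nat \<Rightarrow> ((nat \<Rightarrow> real) \<Rightarrow> complex) \<Rightarrow> ((nat \<Rightarrow> real) \<Rightarrow> complex) \<Rightarrow> complex"
  assumes "b = CARD('p)"
    and "m \<ge> 1"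
    and "s \<ge> 1"
    and "\<alpha> > 1"
    and "\<And>u. u \<subseteq> {1..s} \<Longrightarrow> \<gamma> u > 0"
    and "\<gamma> {} = 1"
    and "mono_on {1..s} w"
    and "\<And>d. d \<in> {1..s} \<Longrightarrow> rkhs (unit_cube d) (walsh_kernel b d \<alpha> \<gamma>) (H d) (ip d)"
    and "reduced_cbc m s w (\<lambda>d v. (worst_case_error m d (H d) (ip d) v)\<^sup>2) g"
  shows "(\<forall>d\<in>{1..s}. \<forall>l\<in>{1/\<alpha><..1}.
            (worst_case_error m d (H d) (ip d) (scaled w g))\<^sup>2
            \<le> (real b / (real b - 1) *
                (\<Sum>u\<in>Pow {1..d} - {{}}. \<gamma> u powr l * mu b (\<alpha> * l) ^ card u
                   / real b ^ nat (max 0 (int m - int (Max (w ` u)))))) powr (1 / l))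
         \<and> (\<forall>\<beta>>1. mu b \<beta> = real b powr \<beta> * (real b - 1) / (real b powr \<beta> - real b))"
proof (intro conjI ballI allI impI)
  fix \<beta> :: real assume "\<beta> > 1"
  then show "mu b \<beta> = real b powr \<beta> * (real b - 1) / (real b powr \<beta> - real b)"
    using mu_eq[OF card_ge_2[where 'p = 'p]] assms(1) by simp
next
  fix d l assume d: "d \<in> {1..s}" and l: "l \<in> {1/\<alpha><..1}"
  note b = \<open>b = CARD('p)\<close>
  define v where "v = scaled w g"
  define bound where "bound d = (\<Sum>u\<in>Pow {1..d} - {{}}. \<gamma> u powr l * mu b (\<alpha> * l) ^ card u
                   / real b ^ nat (max 0 (int m - int (Max (w ` u)))))" for d
  have \<alpha>l: "\<alpha> * l > 1"
    using l \<open>\<alpha> > 1\<close> by (simp add: field_simps)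
  have l01: "0 < l" "l \<le> 1"
    using l \<open>\<alpha> > 1\<close> by (auto intro: less_trans[of 0 "1 / \<alpha>"])
  have wce: "(worst_case_error m d (H d) (ip d) x)\<^sup>2 = lattice_error m \<alpha> \<gamma> d x" if "d \<in> {1..s}"
    for d and x :: "nat \<Rightarrow> 'p mod_ring poly"
  proof -
    have "walsh_rkhs TYPE('p) d \<alpha> \<gamma> (H d) (ip d)"
      using assms(8)[OF that] \<open>\<alpha> > 1\<close> b by (simp add: walsh_rkhs_def walsh_rkhs_axioms_def)
    then show ?thesis
      using walsh_rkhs.worst_case_error_squared[OF _ \<open>m \<ge> 1\<close>] by (simp add: lattice_error_def)
  qed
  \<comment> \<open>The induction starts at d = 0, where both sides are empty sums, so that the
    first component is covered by the general step.\<close>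
  have "lattice_error m \<alpha> \<gamma> d v powr l \<le> real b / (real b - 1) * bound d" if "d \<le> s" for d
    using that
  proof (induction d)
    case 0
    then show ?case
      by (simp add: lattice_error_def bound_def)
  next
    case (Suc d)
    let ?W = "w (Suc d)"
    have \<gamma>: "\<gamma> u > 0" if "u \<subseteq> {1..Suc d}" for u
      using assms(5)[of u] that Suc.prems by fastforce
    have upd: "scaled w (g(Suc d := z)) = v(Suc d := Polynomial.monom 1 ?W * z)" for z
      by (auto simp: scaled_def v_def)
    have min: "error_increment m \<alpha> \<gamma> d v \<le> error_increment m \<alpha> \<gamma> d (v(Suc d := Polynomial.monom 1 ?W * z))"
      if z: "z \<in> search_set m ?W" for z
    proof (cases "d = 0")
      case True
      have "v (Suc 0) = Polynomial.monom 1 (w (Suc 0))"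
        using assms(9) by (simp add: reduced_cbc_def v_def scaled_def)
      then have "v = v(Suc 0 := Polynomial.monom 1 (w (Suc 0)))"
        by auto
      then show ?thesis
        using error_increment_first[of z m "w (Suc 0)" \<alpha> \<gamma> v] z True by simp
    next
      case False
      then have d: "d \<in> {1..<s}" "Suc d \<in> {1..s}"
        using Suc.prems by auto
      then have "\<not> (worst_case_error m (Suc d) (H (Suc d)) (ip (Suc d)) (scaled w (g(Suc d := z))))\<^sup>2
          < (worst_case_error m (Suc d) (H (Suc d)) (ip (Suc d)) (scaled w (g(Suc d := g (Suc d)))))\<^sup>2"
        using assms(9) z by (auto simp: reduced_cbc_def is_arg_min_def)
      \<comment> \<open>The error over the old components does not change with the new one, so
        comparing errors is the same as comparing increments.\<close>
      then show ?thesis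
        unfolding wce[OF d(2)] fun_upd_triv v_def[symmetric] upd lattice_error_Suc lattice_error_update by simp
    qed
    have incr: "error_increment m \<alpha> \<gamma> d v powr l \<le> real b / (real b - 1) *
        (\<Sum>u\<in>Pow {1..d}. \<gamma> (insert (Suc d) u) powr l * mu b (\<alpha> * l) ^ card (insert (Suc d) u) / real b ^ (m - ?W))"
      unfolding b by (rule error_increment_min_le[OF \<gamma> \<open>\<alpha> > 1\<close> \<alpha>l l01 min])
    \<comment> \<open>By monotonicity of w the newest index attains the maximum, so all subsets
      containing it share the denominator that the average over its search set produces.\<close>
    have Max: "Max (w ` insert (Suc d) u) = ?W" if "u \<in> Pow {1..d}" for u
    proof (rule Max_eqI)
      show "finite (w ` insert (Suc d) u)"
        using that by (auto intro: finite_subset)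
      fix y assume "y \<in> w ` insert (Suc d) u"
      moreover have "insert (Suc d) u \<subseteq> {1..Suc d}"
        using that by auto
      ultimately obtain j where "j \<in> {1..Suc d}" "y = w j"
        by blast
      then show "y \<le> ?W"
        using Suc.prems by (auto intro!: mono_onD[OF \<open>mono_on {1..s} w\<close>])
    qed simp
    have "bound (Suc d) = bound d + (\<Sum>u\<in>Pow {1..d}. \<gamma> (insert (Suc d) u) powr l * mu b (\<alpha> * l) ^ card (insert (Suc d) u)
        / real b ^ nat (max 0 (int m - int (Max (w ` insert (Suc d) u)))))"
      unfolding bound_def by (rule sum_nonempty_subsets_Suc)
    also have "\<dots> = bound d + (\<Sum>u\<in>Pow {1..d}. \<gamma> (insert (Suc d) u) powr l * mu b (\<alpha> * l) ^ card (insert (Suc d) u) / real b ^ (m - ?W))"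
      by (intro arg_cong2[where f = "(+)"] sum.cong refl) (simp only: Max, simp add: nat_diff_distrib max_def)
    finally have bound_Suc: "bound (Suc d) = \<dots>" .
    have nonneg: "0 \<le> lattice_error m \<alpha> \<gamma> d v"
      unfolding lattice_error_def
    proof (intro sum_nonneg mult_nonneg_nonneg dual_sum_nonneg)
      fix u assume "u \<in> Pow {1..d} - {{}}"
      then show "0 \<le> \<gamma> u"
        by (intro less_imp_le \<gamma>) auto
    qed
    \<comment> \<open>Subadditivity of the l-th power separates the old error from the increment, so
      the induction hypothesis and the bound for one component simply add up.\<close>
    have "lattice_error m \<alpha> \<gamma> (Suc d) v powr l \<le> lattice_error m \<alpha> \<gamma> d v powr l + error_increment m \<alpha> \<gamma> d v powr l"
      unfolding lattice_error_Suc by (intro powr_add_le nonneg error_increment_nonneg \<gamma> l01)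
    also have "\<dots> \<le> real b / (real b - 1) * bound (Suc d)"
      unfolding bound_Suc distrib_left using Suc by (intro add_mono incr) auto
    finally show ?case .
  qed
  then have "lattice_error m \<alpha> \<gamma> d v powr l \<le> real b / (real b - 1) * bound d"
    using d by simp
  then have "(lattice_error m \<alpha> \<gamma> d v powr l) powr (1 / l) \<le> (real b / (real b - 1) * bound d) powr (1 / l)"
    using l01 by (intro powr_mono2) auto
  moreover have "0 \<le> lattice_error m \<alpha> \<gamma> d v"
    using wce[OF d, of v] by (metis zero_le_power2)
  ultimately show "(worst_case_error m d (H d) (ip d) (scaled w g))\<^sup>2
            \<le> (real b / (real b - 1) *
                (\<Sum>u\<in>Pow {1..d} - {{}}. \<gamma> u powr l * mu b (\<alpha> * l) ^ card u
                   / real b ^ nat (max 0 (int m - int (Max (w ` u)))))) powr (1 / l)"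
    using l01 by (simp add: wce[OF d] powr_powr bound_def v_def)
qed

end
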